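(* Let $\alpha_i,\beta_i,\gamma_i$ ($i=1,2,3$) be real numbers such that $$\operatorname{Rank}\begin{pmatrix}\alpha_1&\beta_1&\gamma_1&0&0&0\\ \alpha_2&\beta_2&\gamma_2&0&0&0\\ 0&0&0&\alpha_3&\beta_3&\gamma_3\end{pmatrix}=3,$$ and let $B_1[u]=\alpha_1u(0)+\beta_1u'(0)+\gamma_1u''(0)$, $B_2[u]=\alpha_2u(0)+\beta_2u'(0)+\gamma_2u''(0)$, $B_3[u]=\alpha_3u(1)+\beta_3u'(1)+\gamma_3u''(1)$. Assume the problem $u'''=\varphi$ on $(0,1)$, $B_1[u]=B_2[u]=B_3[u]=0$ has a Green function $G(t,s)$, and that $G$ and $G_1=\partial G/\partial t$ each have constant sign on $[0,1]^2$. Let $G_2=\partial^2G/\partial t^2$ and $$M_0=\max_{0\le t\le1}\int_0^1|G(t,s)|ds,\quad M_1=\max_{0\le t\le1}\int_0^1|G_1(t,s)|ds,\quad M_2=\max_{0\le t\le1}\int_0^1|G_2(t,s)|ds.$$ For $M>0$ let $$\mathcal{D}_M^+=\{(t,x,y,z): 0\le t\le1,\ 0\le x\le M_0M,\ 0\le\sigma(G)\sigma(G_1)y\le M_1M,\ |z|\le M_2M\}.$$ Suppose there exists $M>0$ such that $f(t,x,y,z)$ is continuous and $0\le\sigma(G)f(t,x,y,z)\le M$ for all $(t,x,y,z)\in\mathcal{D}_M^+$. Then the problem $$u'''(t)=f(t,u(t),u'(t),u''(t)),\ 0<t<1,\qquad B_1[u]=B_2[u]=B_3[u]=0$$ has a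 monotone nonnegative solution $u$ satisfying, for all $0\le t\le 1$, $$0\le u(t)\le M_0M,\quad 0\le\sigma(G)\sigma(G_1)u'(t)\le M_1M,\quad |u''(t)|\le M_2M.$$ In addition, if $\sigma(G)\sigma(G_1)=1$ then the problem has a nonnegative increasing solution, and if $\sigma(G)\sigma(G_1)=-1$ then the problem has a nonnegative decreasing solution.
   Context: The Green function $G(t,s)$ of the linear problem $u'''=\varphi$, $B_1[u]=B_2[u]=B_3[u]=0$ is the function on $[0,1]^2$ such that for every $\varphi\in C[0,1]$ the unique solution is $u(t)=\int_0^1G(t,s)\varphi(s)ds$. For a function $H$ of constant sign on $[0,1]^2$, $\sigma(H)=1$ if $H\ge0$ there and $\sigma(H)=-1$ if $H\le0$ there. *)

theory Defs
  imports "HOL-Analysis.Analysis"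
begin

definition bc_matrix :: "(nat \<Rightarrow> real) \<Rightarrow> (nat \<Rightarrow> real) \<Rightarrow> (nat \<Rightarrow> real) \<Rightarrow> real^6^3" where
  "bc_matrix \<alpha> \<beta> \<gamma> = vector
     [vector [\<alpha> 1, \<beta> 1, \<gamma> 1, 0, 0, 0],
      vector [\<alpha> 2, \<beta> 2, \<gamma> 2, 0, 0, 0],
      vector [0, 0, 0, \<alpha> 3, \<beta> 3, \<gamma> 3]]"

definition third_order_sol ::
  "(real \<Rightarrow> real) \<Rightarrow> (real \<Rightarrow> real) \<Rightarrow> (real \<Rightarrow> real) \<Rightarrow> (real \<Rightarrow> real) \<Rightarrow> bool" where
  "third_order_sol u u1 u2 g \<longleftrightarrow>
     (\<forall>t\<in>{0..1}. (u has_real_derivative u1 t) (at t within {0..1}) \<and>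
                 (u1 has_real_derivative u2 t) (at t within {0..1})) \<and>
     continuous_on {0..1} u2 \<and>
     (\<forall>t\<in>{0<..<1}. (u2 has_real_derivative g t) (at t))"

definition bcs_hold ::
  "(nat \<Rightarrow> real) \<Rightarrow> (nat \<Rightarrow> real) \<Rightarrow> (nat \<Rightarrow> real) \<Rightarrow>
   (real \<Rightarrow> real) \<Rightarrow> (real \<Rightarrow> real) \<Rightarrow> (real \<Rightarrow> real) \<Rightarrow> bool" where
  "bcs_hold \<alpha> \<beta> \<gamma> u u1 u2 \<longleftrightarrow>
     \<alpha> 1 * u 0 + \<beta> 1 * u1 0 + \<gamma> 1 * u2 0 = 0 \<and>
     \<alpha> 2 * u 0 + \<beta> 2 * u1 0 + \<gamma> 2 * u2 0 = 0 \<and>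
     \<alpha> 3 * u 1 + \<beta> 3 * u1 1 + \<gamma> 3 * u2 1 = 0"

definition bvp_solution ::
  "(nat \<Rightarrow> real) \<Rightarrow> (nat \<Rightarrow> real) \<Rightarrow> (nat \<Rightarrow> real) \<Rightarrow>
   (real \<Rightarrow> real) \<Rightarrow> (real \<Rightarrow> real) \<Rightarrow> bool" where
  "bvp_solution \<alpha> \<beta> \<gamma> g u \<longleftrightarrow>
     (\<exists>u1 u2. third_order_sol u u1 u2 g \<and> bcs_hold \<alpha> \<beta> \<gamma> u u1 u2)"

definition green_function ::
  "(nat \<Rightarrow> real) \<Rightarrow> (nat \<Rightarrow> real) \<Rightarrow> (nat \<Rightarrow> real) \<Rightarrow> (real \<Rightarrow> real \<Rightarrow> real) \<Rightarrow> bool" where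
  "green_function \<alpha> \<beta> \<gamma> G \<longleftrightarrow>
     (\<forall>\<phi>. continuous_on {0..1} \<phi> \<longrightarrow>
        (\<exists>u. bvp_solution \<alpha> \<beta> \<gamma> \<phi> u) \<and>
        (\<forall>u. bvp_solution \<alpha> \<beta> \<gamma> \<phi> u \<longrightarrow>
              (\<forall>t\<in>{0..1}. u t = integral {0..1} (\<lambda>s. G t s * \<phi> s))))"

definition constant_sign :: "(real \<Rightarrow> real \<Rightarrow> real) \<Rightarrow> bool" where
  "constant_sign H \<longleftrightarrow>
     (\<forall>t\<in>{0..1}. \<forall>s\<in>{0..1}. 0 \<le> H t s) \<or> (\<forall>t\<in>{0..1}. \<forall>s\<in>{0..1}. H t s \<le> 0)"

definition sigma :: "(real \<Rightarrow> real \<Rightarrow> real) \<Rightarrow> real" where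
  "sigma H = (if (\<forall>t\<in>{0..1}. \<forall>s\<in>{0..1}. 0 \<le> H t s) then 1 else -1)"

end

theory Submission
  imports Defs "HOL-Complex_Analysis.Great_Picard"
begin

text \<open>
  The problem is solved for \<open>\<phi> = \<sigma>(G) u'''\<close>, which has to satisfy a Hammerstein equation
  \<open>\<phi>(t) = g(t, \<integral> \<phi>(s) \<kappa>(t,s) ds)\<close>, where \<open>\<kappa>\<close> collects \<open>G\<close>, \<open>G1\<close>, \<open>G2\<close> and \<open>0 \<le> g \<le> M\<close>.
  Schauder's fixed point theorem is replaced by a compactness argument: Kuhn's lemma gives
  step functions that solve the equation approximately, their images under the integral operator
  are equicontinuous, and a uniform limit of a subsequence of these images yields an exact solution.

  The Green function is only known through its action on continuous functions. It is compared
  with an explicit kernel, the Volterra kernel \<open>(t - s)\<^sup>2 / 2\<close> for \<open>s \<le> t\<close> plus a rank-one boundary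
  correction \<open>p(t) q(s)\<close>. For each fixed \<open>t\<close> the two kernels and their \<open>t\<close>-derivatives agree for
  almost every \<open>s\<close>, so the sign conditions and the constants \<open>M0\<close>, \<open>M1\<close>, \<open>M2\<close> transfer.
\<close>

section \<open>Hammerstein equations\<close>

text \<open>One vector-valued kernel carries all components of the unknown, hence the type
  \<open>'b\<close>. Continuity in the first argument is required off the diagonal only, since the
  second derivative of a Green function jumps at s = t. The function \<open>g\<close> is controlled
  on \<open>D\<close> alone, so its uses come with a proof of membership in
  \<open>D\<close>.\<close>

locale hammerstein =
  fixes \<kappa> :: "real \<Rightarrow> real \<Rightarrow> 'b::euclidean_space" and C M :: real
    and g :: "real \<times> 'b \<Rightarrow> real" and D :: "(real \<times> 'b) set"
  assumes kernel_measurable: "t \<in> {0..1} \<Longrightarrow> \<kappa> t \<in> borel_measurable (lebesgue_on {0..1})"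
    and kernel_bound: "t \<in> {0..1} \<Longrightarrow> s \<in> {0..1} \<Longrightarrow> norm (\<kappa> t s) \<le> C"
    and kernel_continuous: "t \<in> {0..1} \<Longrightarrow> s \<in> {0..1} \<Longrightarrow> s \<noteq> t \<Longrightarrow>
          continuous (at t within {0..1}) (\<lambda>\<tau>. \<kappa> \<tau> s)"
    and closed_domain: "closed D"
    and g_continuous: "continuous_on D g"
    and g_bounds: "x \<in> D \<Longrightarrow> 0 \<le> g x \<and> g x \<le> M"
    and M_nonneg: "0 \<le> M"
begin

text \<open>Measurable instead of continuous functions, so that the step functions of the
  discretisation are admissible.\<close>

definition Adm :: "(real \<Rightarrow> real) set" where
  "Adm = {\<phi> \<in> borel_measurable (lebesgue_on {0..1}). \<forall>s\<in>{0..1}. 0 \<le> \<phi> s \<and> \<phi> s \<le> M}"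

definition K :: "(real \<Rightarrow> real) \<Rightarrow> real \<Rightarrow> 'b" where
  "K \<phi> t = integral {0..1} (\<lambda>s. \<phi> s *\<^sub>R \<kappa> t s)"

lemma C_nonneg: "0 \<le> C"
  using order_trans[OF norm_ge_zero kernel_bound[of 0 0]] by simp

lemma norm_scaled_kernel_le:
  assumes "\<phi> \<in> Adm" "t \<in> {0..1}" "s \<in> {0..1}"
  shows "norm (\<phi> s *\<^sub>R \<kappa> t s) \<le> M * C"
  using assms kernel_bound[of t s] by (auto simp: Adm_def intro!: mult_mono M_nonneg)

lemma integrable_scaled_kernel:
  assumes "\<phi> \<in> Adm" "t \<in> {0..1}"
  shows "(\<lambda>s. \<phi> s *\<^sub>R \<kappa> t s) integrable_on {0..1}"
proof (rule measurable_bounded_by_integrable_imp_integrable)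
  show "(\<lambda>s. \<phi> s *\<^sub>R \<kappa> t s) \<in> borel_measurable (lebesgue_on {0..1})"
    using assms kernel_measurable by (auto simp: Adm_def)
  show "(\<lambda>_. M * C) integrable_on {0..1::real}" by (rule integrable_const_ivl)
  show "norm (\<phi> s *\<^sub>R \<kappa> t s) \<le> M * C" if "s \<in> {0..1}" for s
    using norm_scaled_kernel_le assms that by blast
qed auto

lemma norm_K_le:
  assumes "\<phi> \<in> Adm" "t \<in> {0..1}"
  shows "norm (K \<phi> t) \<le> M * C"
proof -
  have "norm (K \<phi> t) \<le> integral {0..1::real} (\<lambda>_. M * C)"
    unfolding K_def using assms norm_scaled_kernel_le
    by (intro integral_norm_bound_integral integrable_scaled_kernel integrable_const_ivl) auto
  then show ?thesis by simp
qed

lemma norm_K_diff_le: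
  assumes "\<phi> \<in> Adm" "\<psi> \<in> Adm" "t \<in> {0..1}" and near: "\<And>s. s \<in> {0..1} \<Longrightarrow> \<bar>\<phi> s - \<psi> s\<bar> \<le> \<eta>"
  shows "norm (K \<phi> t - K \<psi> t) \<le> \<eta> * C"
proof -
  have "K \<phi> t - K \<psi> t = integral {0..1} (\<lambda>s. \<phi> s *\<^sub>R \<kappa> t s - \<psi> s *\<^sub>R \<kappa> t s)"
    unfolding K_def using assms by (simp add: integral_diff integrable_scaled_kernel)
  also have "norm \<dots> \<le> integral {0..1::real} (\<lambda>_. \<eta> * C)"
  proof (intro integral_norm_bound_integral integrable_diff integrable_scaled_kernel assms integrable_const_ivl)
    fix s :: real assume s: "s \<in> {0..1}"
    have "norm (\<phi> s *\<^sub>R \<kappa> t s - \<psi> s *\<^sub>R \<kappa> t s) = \<bar>\<phi> s - \<psi> s\<bar> * norm (\<kappa> t s)"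
      by (simp flip: scaleR_diff_left)
    also have "\<dots> \<le> \<eta> * C"
      using near[OF s] kernel_bound[OF \<open>t \<in> {0..1}\<close> s] by (intro mult_mono) auto
    finally show "norm (\<phi> s *\<^sub>R \<kappa> t s - \<psi> s *\<^sub>R \<kappa> t s) \<le> \<eta> * C" .
  qed
  finally show ?thesis by simp
qed

lemma integrable_norm_kernel_diff:
  assumes "t \<in> {0..1}" "t' \<in> {0..1}"
  shows "(\<lambda>s. norm (\<kappa> t' s - \<kappa> t s)) integrable_on {0..1}"
proof (rule measurable_bounded_by_integrable_imp_integrable)
  show "(\<lambda>s. norm (\<kappa> t' s - \<kappa> t s)) \<in> borel_measurable (lebesgue_on {0..1})"
    using assms kernel_measurable by auto
  show "(\<lambda>_. C + C) integrable_on {0..1::real}" by (rule integrable_const_ivl)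
  show "norm (norm (\<kappa> t' s - \<kappa> t s)) \<le> C + C" if "s \<in> {0..1}" for s
    using kernel_bound[OF assms(1) that] kernel_bound[OF assms(2) that]
      norm_triangle_ineq4[of "\<kappa> t' s" "\<kappa> t s"] by simp
qed auto

text \<open>Dominated convergence with the constant majorant \<open>C + C\<close>, along an
  arbitrary sequence that tends to \<open>t\<close>. Pointwise convergence can fail only at s =
  t.\<close>

lemma kernel_L1_continuous:
  assumes t: "t \<in> {0..1}"
  shows "((\<lambda>t'. integral {0..1} (\<lambda>s. norm (\<kappa> t' s - \<kappa> t s))) \<longlongrightarrow> 0) (at t within {0..1})"
  unfolding tendsto_at_iff_sequentially comp_def
proof (intro allI impI)
  fix X :: "nat \<Rightarrow> real"
  assume X: "\<forall>n. X n \<in> {0..1} - {t}" and lim: "X \<longlonglongrightarrow> t"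
  \<comment> \<open>The convergence theorem asks for convergence at every point. Setting the
    integrand to 0 at s = t achieves this and changes no integral.\<close>
  let ?f = "\<lambda>n s. if s = t then 0 else norm (\<kappa> (X n) s - \<kappa> t s)"
  have int: "?f n integrable_on {0..1}" for n
    using integrable_spike_finite[of "{t}" "{0..1}" "?f n" "\<lambda>s. norm (\<kappa> (X n) s - \<kappa> t s)"]
      integrable_norm_kernel_diff[OF t, of "X n"] X by auto
  have "(\<lambda>n. integral {0..1} (?f n)) \<longlonglongrightarrow> integral {0..1} (\<lambda>s::real. 0::real)"
  proof (rule dominated_convergence(2)[where h="\<lambda>_. C + C"])
    show "norm (?f n s) \<le> C + C" if "s \<in> {0..1}" for n s
      using kernel_bound[OF _ that, of "X n"] kernel_bound[OF t that] X C_nonneg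
        norm_triangle_ineq4[of "\<kappa> (X n) s" "\<kappa> t s"] by auto
    show "(\<lambda>n. ?f n s) \<longlonglongrightarrow> 0" if s: "s \<in> {0..1}" for s
    proof (cases "s = t")
      case False
      have "((\<lambda>\<tau>. \<kappa> \<tau> s) \<longlongrightarrow> \<kappa> t s) (at t within {0..1})"
        using kernel_continuous[OF t s False] by (simp add: continuous_within)
      then have "(\<lambda>n. \<kappa> (X n) s) \<longlonglongrightarrow> \<kappa> t s"
        using X lim unfolding tendsto_at_iff_sequentially comp_def by blast
      then show ?thesis
        using False by (auto simp: LIM_zero_iff intro!: tendsto_norm_zero)
    qed auto
  qed (auto simp: int)
  moreover have "integral {0..1} (?f n) = integral {0..1} (\<lambda>s. norm (\<kappa> (X n) s - \<kappa> t s))" for n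
    by (rule integral_spike[of "{t}"]) auto
  ultimately show "(\<lambda>n. integral {0..1} (\<lambda>s. norm (\<kappa> (X n) s - \<kappa> t s))) \<longlonglongrightarrow> 0"
    by simp
qed

text \<open>Since 0 \<le> \<phi> \<le> M, the change of \<open>K \<phi>\<close> is at most M times
  the L1 distance of the two kernel sections, a bound that is uniform in \<phi>.\<close>

lemma K_equicontinuous:
  assumes t: "t \<in> {0..1}" and "0 < e"
  obtains d where "0 < d"
    "\<And>\<phi> t'. \<phi> \<in> Adm \<Longrightarrow> t' \<in> {0..1} \<Longrightarrow> \<bar>t' - t\<bar> < d \<Longrightarrow> norm (K \<phi> t' - K \<phi> t) < e"
proof -
  let ?W = "\<lambda>t'. integral {0..1} (\<lambda>s. norm (\<kappa> t' s - \<kappa> t s))"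
  \<comment> \<open>Dividing by M + 1 instead of M covers M = 0 and makes the final estimate
    strict.\<close>
  define e' where "e' = e / (M + 1)"
  have "0 < e'" using M_nonneg \<open>0 < e\<close> by (simp add: e'_def)
  then have "\<forall>\<^sub>F t' in at t within {0..1}. dist (?W t') 0 < e'"
    by (rule tendstoD[OF kernel_L1_continuous[OF t]])
  then obtain d where d: "0 < d"
    and W: "\<And>t'. t' \<in> {0..1} \<Longrightarrow> t' \<noteq> t \<Longrightarrow> dist t' t < d \<Longrightarrow> dist (?W t') 0 < e'"
    unfolding eventually_at by blast
  show thesis
  proof
    show "0 < d" by fact
    fix \<phi> t' assume \<phi>: "\<phi> \<in> Adm" and t': "t' \<in> {0..1}" and close: "\<bar>t' - t\<bar> < d"
    have "K \<phi> t' - K \<phi> t = integral {0..1} (\<lambda>s. \<phi> s *\<^sub>R \<kappa> t' s - \<phi> s *\<^sub>R \<kappa> t s)"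
      unfolding K_def using \<phi> t t' by (simp add: integral_diff integrable_scaled_kernel)
    also have "norm \<dots> \<le> integral {0..1} (\<lambda>s. M * norm (\<kappa> t' s - \<kappa> t s))"
    proof (intro integral_norm_bound_integral integrable_diff integrable_scaled_kernel \<phi> t t'
          integrable_on_mult_right integrable_norm_kernel_diff)
      fix s :: real assume s: "s \<in> {0..1}"
      show "norm (\<phi> s *\<^sub>R \<kappa> t' s - \<phi> s *\<^sub>R \<kappa> t s) \<le> M * norm (\<kappa> t' s - \<kappa> t s)"
        using \<phi> s by (auto simp: Adm_def simp flip: scaleR_diff_right intro!: mult_right_mono)
    qed
    also have "\<dots> = M * ?W t'" by simp
    also have "\<dots> < e"
    proof (cases "t' = t")
      case False
      have "?W t' < e'" using W[OF t' False] close by (simp add: dist_real_def)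
      then have "M * ?W t' \<le> M * e'" using M_nonneg by (simp add: mult_left_mono)
      also have "\<dots> < e" using M_nonneg \<open>0 < e\<close> by (simp add: e'_def field_simps)
      finally show ?thesis .
    qed (use \<open>0 < e\<close> in simp)
    finally show "norm (K \<phi> t' - K \<phi> t) < e" .
  qed
qed

section \<open>Discretisation by step functions\<close>

definition step_fun :: "nat \<Rightarrow> (nat \<Rightarrow> nat) \<Rightarrow> real \<Rightarrow> real" where
  "step_fun N x s = M * real (x (nat \<lfloor>real N * s\<rfloor>)) / real N"

text \<open>The cells [i/N, (i+1)/N) have the indices 0 to N - 1, and the point 1 alone has the
  index N. This is why step functions have N + 1 levels.\<close>

lemma grid_index_le:
  fixes s :: real
  assumes "s \<in> {0..1}"
  shows "nat \<lfloor>real N * s\<rfloor> \<le> N"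
proof -
  have "real N * s \<le> real N" using assms mult_left_mono[of s 1 "real N"] by simp
  then show ?thesis by linarith
qed

lemma step_fun_Adm:
  assumes "0 < N" "\<And>i. i \<le> N \<Longrightarrow> x i \<le> N"
  shows "step_fun N x \<in> Adm"
proof -
  have "(\<lambda>s::real. real (x (nat \<lfloor>real N * s\<rfloor>))) \<in> borel_measurable borel"
    by measurable
  then have "step_fun N x \<in> borel_measurable borel"
    unfolding step_fun_def by measurable
  then have "step_fun N x \<in> borel_measurable (lebesgue_on {0..1})"
    by (intro measurable_restrict_space1 measurable_completion) simp
  moreover have "0 \<le> step_fun N x s \<and> step_fun N x s \<le> M" if "s \<in> {0..1}" for s
  proof -
    have "real (x (nat \<lfloor>real N * s\<rfloor>)) \<le> real N"
      using assms(2)[OF grid_index_le[OF that]] by simp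
    then show ?thesis
      using \<open>0 < N\<close> M_nonneg by (simp add: step_fun_def field_simps mult_left_mono)
  qed
  ultimately show ?thesis by (simp add: Adm_def)
qed

text \<open>Kuhn's combinatorial lemma replaces Brouwer's theorem, since the number of grid values varies:
  the labels record, value by value, whether the discretised operator increases or decreases it.\<close>
lemma approximate_solution:
  fixes N :: nat
  assumes range: "\<And>\<phi> t. \<phi> \<in> Adm \<Longrightarrow> t \<in> {0..1} \<Longrightarrow> (t, K \<phi> t) \<in> D" and N: "0 < N"
  obtains \<phi> where "\<phi> \<in> Adm"
    "\<And>s. s \<in> {0..1} \<Longrightarrow> \<exists>t\<in>{0..1}. \<bar>t - s\<bar> \<le> 1 / N \<and>
       (\<exists>\<psi>\<in>Adm. \<exists>\<omega>\<in>Adm. (\<forall>r\<in>{0..1}. \<bar>\<psi> r - \<phi> r\<bar> \<le> M / N) \<and> (\<forall>r\<in>{0..1}. \<bar>\<omega> r - \<phi> r\<bar> \<le> M / N) \<and>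
          \<phi> s \<le> g (t, K \<psi> t) \<and> g (t, K \<omega> t) - M / N \<le> \<phi> s)"
proof -
  define F where "F x i = g (real i / N, K (step_fun N x) (real i / N))" for x i
  \<comment> \<open>Label 1 means that level \<open>x i\<close> should not rise, label 0 that it
    should not fall. Level 0 always has label 0 and level N always label 1, as Kuhn's lemma demands;
    the latter is consistent because \<open>F x i\<close> is at most M.\<close>
  define label where
    "label x i = (if x i = N \<or> (x i \<noteq> 0 \<and> F x i < M * real (x i) / N) then 1 else (0::nat))" for x i
  have F_bounds: "0 \<le> F x i \<and> F x i \<le> M" if "\<forall>j\<le>N. x j \<le> N" "i \<le> N" for x i
    unfolding F_def using that N by (intro g_bounds range step_fun_Adm) auto
  \<comment> \<open>The dimension is \<open>Suc N\<close>, one coordinate for each grid index. In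
    the unit cube with lowest corner \<open>q\<close> each coordinate sees both labels.\<close>
  obtain q where q: "\<forall>i<Suc N. q i < N"
    and rs: "\<forall>i<Suc N. \<exists>r s. (\<forall>j<Suc N. q j \<le> r j \<and> r j \<le> q j + 1) \<and>
        (\<forall>j<Suc N. q j \<le> s j \<and> s j \<le> q j + 1) \<and> label r i \<noteq> label s i"
  proof (rule kuhn_lemma[of N "Suc N" label])
    show "0 < N" by fact
  qed (use N in \<open>auto simp: label_def\<close>)
  have step_fun_near: "\<bar>step_fun N x r - step_fun N q r\<bar> \<le> M / N"
    if x: "\<forall>j\<le>N. q j \<le> x j \<and> x j \<le> q j + 1" and r: "r \<in> {0..1}" for x and r :: real
  proof -
    define j where "j = nat \<lfloor>real N * r\<rfloor>"
    have j: "q j \<le> x j" "x j \<le> q j + 1" using x grid_index_le[OF r] by (auto simp: j_def)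
    have "step_fun N x r - step_fun N q r = M / N * (real (x j) - real (q j))"
      by (simp add: step_fun_def j_def diff_divide_distrib right_diff_distrib)
    moreover have "\<bar>real (x j) - real (q j)\<bar> \<le> 1" using j by linarith
    ultimately show ?thesis
      using mult_left_mono[of "\<bar>real (x j) - real (q j)\<bar>" 1 "M / N"] M_nonneg by (simp add: abs_mult)
  qed
  show thesis
  proof
    show "step_fun N q \<in> Adm" using q N by (intro step_fun_Adm) (auto simp: less_Suc_eq_le less_imp_le)
    fix s :: real assume s: "s \<in> {0..1}"
    define i where "i = nat \<lfloor>real N * s\<rfloor>"
    have i: "i \<le> N" using grid_index_le[OF s] by (simp add: i_def)
    have "real i \<le> N * s" "N * s < real i + 1"
      using s N by (auto simp: i_def)
    then have "\<bar>real i - N * s\<bar> \<le> 1" by linarith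
    moreover have "real i / N - s = (real i - N * s) / N" using N by (simp add: field_simps)
    ultimately have ti: "real i / N \<in> {0..1}" "\<bar>real i / N - s\<bar> \<le> 1 / N"
      using i N by (auto intro: divide_right_mono)
    \<comment> \<open>Two corners of the cube with opposite labels at \<open>i\<close>: at
      \<open>a\<close> the operator is at least the current value, at \<open>b\<close> at most. They
      depend on \<open>i\<close>, so the two perturbations \<psi> and \<omega> in the conclusion
      depend on \<open>s\<close>.\<close>
    obtain a b where "\<forall>j\<le>N. q j \<le> a j \<and> a j \<le> q j + 1" "\<forall>j\<le>N. q j \<le> b j \<and> b j \<le> q j + 1"
      "label a i = 0" "label b i = 1"
    proof -
      obtain r s where *: "\<forall>j\<le>N. q j \<le> r j \<and> r j \<le> q j + 1" "\<forall>j\<le>N. q j \<le> s j \<and> s j \<le> q j + 1"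
        "label r i \<noteq> label s i"
        using rs[unfolded less_Suc_eq_le] i by blast
      then show thesis
        using that[of r s] that[of s r] by (cases "label r i = 0") (auto simp: label_def split: if_splits)
    qed
    note ab = this
    have le: "\<forall>j\<le>N. a j \<le> N" "\<forall>j\<le>N. b j \<le> N"
      using ab(1,2) q by (fastforce simp: less_Suc_eq_le)+
    have mono: "M * real m / N \<le> M * real n / N" if "m \<le> n" for m n
      using that M_nonneg by (intro divide_right_mono mult_left_mono) auto
    have phi: "step_fun N q s = M * real (q i) / N" by (simp add: step_fun_def i_def)
    have "step_fun N q s \<le> M * real (a i) / N"
      unfolding phi using ab i by (intro mono) auto
    also have "\<dots> \<le> F a i"
      using ab(3) F_bounds[OF le(1) i] by (auto simp: label_def split: if_splits)
    finally have lower: "step_fun N q s \<le> F a i" .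
    have "F b i \<le> M * real (b i) / N"
      using ab(4) F_bounds[OF le(2) i] N by (auto simp: label_def split: if_splits)
    also have "\<dots> \<le> M * real (q i + 1) / N"
      using ab i by (intro mono) auto
    also have "\<dots> = step_fun N q s + M / N"
      by (simp add: phi field_simps add_divide_distrib)
    finally have upper: "F b i - M / N \<le> step_fun N q s" by simp
    show "\<exists>t\<in>{0..1}. \<bar>t - s\<bar> \<le> 1 / N \<and>
       (\<exists>\<psi>\<in>Adm. \<exists>\<omega>\<in>Adm. (\<forall>r\<in>{0..1}. \<bar>\<psi> r - step_fun N q r\<bar> \<le> M / N) \<and> (\<forall>r\<in>{0..1}. \<bar>\<omega> r - step_fun N q r\<bar> \<le> M / N) \<and>
          step_fun N q s \<le> g (t, K \<psi> t) \<and> g (t, K \<omega> t) - M / N \<le> step_fun N q s)"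
    proof (intro bexI conjI ballI)
      show "step_fun N q s \<le> g (real i / N, K (step_fun N a) (real i / N))"
        "g (real i / N, K (step_fun N b) (real i / N)) - M / N \<le> step_fun N q s"
        using lower upper by (auto simp: F_def)
      show "step_fun N a \<in> Adm" "step_fun N b \<in> Adm" using le by (auto intro!: step_fun_Adm N)
    qed (use ti step_fun_near ab in auto)
  qed
qed

text \<open>Nothing is known about convergence of the approximate solutions, but by Arzela-Ascoli
  their images under \<open>K\<close> have a uniform limit \<open>U\<close> along a subsequence.
  Continuity of \<open>g\<close> then forces the approximate solutions to converge pointwise to
  \<open>g (s, U s)\<close>, and dominated convergence identifies \<open>U\<close> with the image of
  this limit. Closedness of \<open>D\<close> keeps the limit points in the domain of
  \<open>g\<close>.\<close>

theorem solution_exists: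
  assumes range: "\<And>\<phi> t. \<phi> \<in> Adm \<Longrightarrow> t \<in> {0..1} \<Longrightarrow> (t, K \<phi> t) \<in> D"
  obtains \<phi> where "\<phi> \<in> Adm" "continuous_on {0..1} \<phi>" "\<And>t. t \<in> {0..1} \<Longrightarrow> \<phi> t = g (t, K \<phi> t)"
proof -
  have "\<exists>\<phi>\<in>Adm. \<forall>s\<in>{0..1}. \<exists>t\<in>{0..1}. \<bar>t - s\<bar> \<le> 1 / Suc n \<and>
       (\<exists>\<psi>\<in>Adm. \<exists>\<omega>\<in>Adm. (\<forall>r\<in>{0..1}. \<bar>\<psi> r - \<phi> r\<bar> \<le> M / Suc n) \<and>
          (\<forall>r\<in>{0..1}. \<bar>\<omega> r - \<phi> r\<bar> \<le> M / Suc n) \<and>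
          \<phi> s \<le> g (t, K \<psi> t) \<and> g (t, K \<omega> t) - M / Suc n \<le> \<phi> s)" for n
    by (rule approximate_solution[OF range, of "Suc n"]) blast+
  then obtain \<phi> where \<phi>: "\<And>n. \<phi> n \<in> Adm"
    and approx: "\<And>n s. s \<in> {0..1} \<Longrightarrow> \<exists>t\<in>{0..1}. \<bar>t - s\<bar> \<le> 1 / Suc n \<and>
       (\<exists>\<psi>\<in>Adm. \<exists>\<omega>\<in>Adm. (\<forall>r\<in>{0..1}. \<bar>\<psi> r - \<phi> n r\<bar> \<le> M / Suc n) \<and>
          (\<forall>r\<in>{0..1}. \<bar>\<omega> r - \<phi> n r\<bar> \<le> M / Suc n) \<and>
          \<phi> n s \<le> g (t, K \<psi> t) \<and> g (t, K \<omega> t) - M / Suc n \<le> \<phi> n s)"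
    by metis
  obtain U k where U_cont: "continuous_on {0..1} U" and k: "strict_mono (k :: nat \<Rightarrow> nat)"
    and unif: "\<And>e. 0 < e \<Longrightarrow> \<exists>N. \<forall>n x. n \<ge> N \<and> x \<in> {0..1} \<longrightarrow> norm (K (\<phi> (k n)) x - U x) < e"
  proof (rule Arzela_Ascoli[of "{0..1::real}" "\<lambda>n. K (\<phi> n)" "M * C"])
    show "norm (K (\<phi> n) x) \<le> M * C" if "x \<in> {0..1}" for n x
      using norm_K_le \<phi> that by blast
    show "\<exists>d>0. \<forall>n y. y \<in> {0..1} \<and> norm (x - y) < d \<longrightarrow> norm (K (\<phi> n) x - K (\<phi> n) y) < e"
      if "x \<in> {0..1}" "0 < e" for x e
      using K_equicontinuous[OF that] \<phi> by (metis norm_minus_commute real_norm_def)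
  qed auto
  have ptw: "(\<lambda>n. K (\<phi> (k n)) t) \<longlonglongrightarrow> U t" if "t \<in> {0..1}" for t
    unfolding LIMSEQ_iff using unif that by blast
  have inv0: "(\<lambda>n. c / Suc (k n)) \<longlonglongrightarrow> 0" for c :: real
    using LIMSEQ_subseq_LIMSEQ[OF LIMSEQ_Suc[OF lim_const_over_n[of c]] k] by (simp add: o_def)
  \<comment> \<open>All three perturbations vanish in the limit: the nodes \<open>t n\<close> tend
    to \<open>s\<close>, replacing \<open>\<psi> n\<close> by \<open>\<phi> (k n)\<close> costs at
    most \<open>M / Suc (k n) * C\<close>, and moving the node to \<open>s\<close> is controlled by
    equicontinuity.\<close>
  have seq: "(\<lambda>n. g (t n, K (\<psi> n) (t n))) \<longlonglongrightarrow> g (s, U s)"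
    if s: "s \<in> {0..1}" and t: "\<And>n. t n \<in> {0..1}" "\<And>n. \<bar>t n - s\<bar> \<le> 1 / Suc (k n)"
      and \<psi>: "\<And>n. \<psi> n \<in> Adm" "\<And>n r. r \<in> {0..1} \<Longrightarrow> \<bar>\<psi> n r - \<phi> (k n) r\<bar> \<le> M / Suc (k n)"
    for s t \<psi>
  proof -
    have t_lim: "t \<longlonglongrightarrow> s"
      using Lim_null_comparison[of "\<lambda>n. t n - s", OF _ inv0[of 1]] t(2) by (simp add: LIM_zero_iff)
    have 1: "(\<lambda>n. K (\<psi> n) (t n) - K (\<phi> (k n)) (t n)) \<longlonglongrightarrow> 0"
    proof (rule Lim_null_comparison)
      show "\<forall>\<^sub>F n in sequentially. norm (K (\<psi> n) (t n) - K (\<phi> (k n)) (t n)) \<le> M / Suc (k n) * C"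
        using norm_K_diff_le[OF \<psi>(1) \<phi> t(1) \<psi>(2)] by simp
      show "(\<lambda>n. M / Suc (k n) * C) \<longlonglongrightarrow> 0"
        using tendsto_mult_left_zero[OF inv0[of M]] by simp
    qed
    have 2: "(\<lambda>n. K (\<phi> (k n)) (t n) - K (\<phi> (k n)) s) \<longlonglongrightarrow> 0"
      unfolding LIMSEQ_iff
    proof (intro allI impI)
      fix e :: real assume "0 < e"
      then obtain d where "0 < d" and d: "\<And>\<phi> t'. \<phi> \<in> Adm \<Longrightarrow> t' \<in> {0..1} \<Longrightarrow> \<bar>t' - s\<bar> < d \<Longrightarrow>
          norm (K \<phi> t' - K \<phi> s) < e"
        using K_equicontinuous[OF s] by blast
      obtain m where "\<forall>n\<ge>m. norm (t n - s) < d"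
        using t_lim \<open>0 < d\<close> unfolding LIMSEQ_iff by blast
      then show "\<exists>m. \<forall>n\<ge>m. norm (K (\<phi> (k n)) (t n) - K (\<phi> (k n)) s - 0) < e"
        using d[OF \<phi> t(1)] by auto
    qed
    have "(\<lambda>n. K (\<psi> n) (t n)) \<longlonglongrightarrow> U s"
      using tendsto_add[OF tendsto_add[OF 1 2] ptw[OF s]] by simp
    then have lim: "(\<lambda>n. (t n, K (\<psi> n) (t n))) \<longlonglongrightarrow> (s, U s)"
      using t_lim by (rule tendsto_Pair[rotated])
    have mem: "(t n, K (\<psi> n) (t n)) \<in> D" for n using range \<psi>(1) t(1) by blast
    then have "(s, U s) \<in> D"
      using closed_sequentially[OF closed_domain _ lim] by blast
    then show ?thesis
      using continuous_on_tendsto_compose[OF g_continuous lim] mem by simp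
  qed
  \<comment> \<open>The values are squeezed between two sequences of the form treated in
    \<open>seq\<close>, the lower one shifted by a null sequence.\<close>
  have conv: "(\<lambda>n. \<phi> (k n) s) \<longlonglongrightarrow> g (s, U s)" if s: "s \<in> {0..1}" for s
  proof -
    obtain t \<psi> \<omega> where t: "\<And>n. t n \<in> {0..1}" "\<And>n. \<bar>t n - s\<bar> \<le> 1 / Suc (k n)"
      and \<psi>: "\<And>n. \<psi> n \<in> Adm" "\<And>n r. r \<in> {0..1} \<Longrightarrow> \<bar>\<psi> n r - \<phi> (k n) r\<bar> \<le> M / Suc (k n)"
      and \<omega>: "\<And>n. \<omega> n \<in> Adm" "\<And>n r. r \<in> {0..1} \<Longrightarrow> \<bar>\<omega> n r - \<phi> (k n) r\<bar> \<le> M / Suc (k n)"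
      and bounds: "\<And>n. \<phi> (k n) s \<le> g (t n, K (\<psi> n) (t n))"
        "\<And>n. g (t n, K (\<omega> n) (t n)) - M / Suc (k n) \<le> \<phi> (k n) s"
    proof -
      have "\<forall>n. \<exists>t \<psi> \<omega>. (t \<in> {0..1} \<and> \<bar>t - s\<bar> \<le> 1 / Suc (k n)) \<and>
          (\<psi> \<in> Adm \<and> (\<forall>r\<in>{0..1}. \<bar>\<psi> r - \<phi> (k n) r\<bar> \<le> M / Suc (k n))) \<and>
          (\<omega> \<in> Adm \<and> (\<forall>r\<in>{0..1}. \<bar>\<omega> r - \<phi> (k n) r\<bar> \<le> M / Suc (k n))) \<and>
          \<phi> (k n) s \<le> g (t, K \<psi> t) \<and> g (t, K \<omega> t) - M / Suc (k n) \<le> \<phi> (k n) s"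
        using approx[OF s] by blast
      then obtain t \<psi> \<omega> where "\<forall>n. (t n \<in> {0..1} \<and> \<bar>t n - s\<bar> \<le> 1 / Suc (k n)) \<and>
          (\<psi> n \<in> Adm \<and> (\<forall>r\<in>{0..1}. \<bar>\<psi> n r - \<phi> (k n) r\<bar> \<le> M / Suc (k n))) \<and>
          (\<omega> n \<in> Adm \<and> (\<forall>r\<in>{0..1}. \<bar>\<omega> n r - \<phi> (k n) r\<bar> \<le> M / Suc (k n))) \<and>
          \<phi> (k n) s \<le> g (t n, K (\<psi> n) (t n)) \<and> g (t n, K (\<omega> n) (t n)) - M / Suc (k n) \<le> \<phi> (k n) s"
        unfolding choice_iff by blast
      then show thesis
        by (intro that[of t \<psi> \<omega>]) blast+
    qed
    have upper: "(\<lambda>n. g (t n, K (\<psi> n) (t n))) \<longlonglongrightarrow> g (s, U s)"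
      by (rule seq[OF s t \<psi>(1)]) (rule \<psi>(2))
    have "(\<lambda>n. g (t n, K (\<omega> n) (t n))) \<longlonglongrightarrow> g (s, U s)"
      by (rule seq[OF s t \<omega>(1)]) (rule \<omega>(2))
    then have lower: "(\<lambda>n. g (t n, K (\<omega> n) (t n)) - M / Suc (k n)) \<longlonglongrightarrow> g (s, U s)"
      using tendsto_diff[OF _ inv0[of M]] by fastforce
    show ?thesis
      by (rule tendsto_sandwich[OF _ _ lower upper]) (intro always_eventually allI bounds)+
  qed
  have UD: "(s, U s) \<in> D" if "s \<in> {0..1}" for s
    using closed_sequentially[OF closed_domain _ tendsto_Pair[OF tendsto_const ptw[OF that]]] range \<phi> that
    by blast
  define \<Phi> where "\<Phi> s = g (s, U s)" for s
  have \<Phi>_cont: "continuous_on {0..1} \<Phi>"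
    unfolding \<Phi>_def using UD
    by (intro continuous_on_compose2[OF g_continuous] continuous_on_Pair continuous_on_id U_cont) auto
  have \<Phi>_Adm: "\<Phi> \<in> Adm"
    unfolding Adm_def using UD g_bounds continuous_imp_measurable_on_sets_lebesgue[OF \<Phi>_cont]
    by (auto simp: \<Phi>_def)
  have "K \<Phi> t = U t" if t: "t \<in> {0..1}" for t
  proof (rule LIMSEQ_unique[OF _ ptw[OF t]])
    show "(\<lambda>n. K (\<phi> (k n)) t) \<longlonglongrightarrow> K \<Phi> t"
      unfolding K_def
    proof (rule dominated_convergence(2)[where h="\<lambda>_. M * C"])
      show "(\<lambda>n. \<phi> (k n) s *\<^sub>R \<kappa> t s) \<longlonglongrightarrow> \<Phi> s *\<^sub>R \<kappa> t s" if "s \<in> {0..1}" for s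
        unfolding \<Phi>_def by (intro tendsto_scaleR conv that tendsto_const)
    qed (auto intro!: integrable_scaled_kernel norm_scaled_kernel_le[simplified] \<phi> t[simplified])
  qed
  then show thesis
    using that[OF \<Phi>_Adm \<Phi>_cont] by (simp add: \<Phi>_def)
qed

end

section \<open>Kernels that agree almost everywhere\<close>

text \<open>A countable union of null sets is null, and outside it the two sequences coincide, so
  uniqueness of limits applies.\<close>

lemma negligible_neq_limit:
  fixes a b :: "nat \<Rightarrow> 'a::euclidean_space \<Rightarrow> 'b::t2_space"
  assumes neq: "\<And>n. negligible {s \<in> S. a n s \<noteq> b n s}" and N: "negligible N"
    and a: "\<And>s. s \<in> S - N \<Longrightarrow> (\<lambda>n. a n s) \<longlonglongrightarrow> a' s"
    and b: "\<And>s. s \<in> S - N \<Longrightarrow> (\<lambda>n. b n s) \<longlonglongrightarrow> b' s"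
  shows "negligible {s \<in> S. a' s \<noteq> b' s}"
proof (rule negligible_subset)
  show "negligible (N \<union> (\<Union>n. {s \<in> S. a n s \<noteq> b n s}))"
    by (intro negligible_Un N negligible_Union_nat neq)
  show "{s \<in> S. a' s \<noteq> b' s} \<subseteq> N \<union> (\<Union>n. {s \<in> S. a n s \<noteq> b n s})"
  proof (rule ccontr)
    assume "\<not> ?thesis"
    then obtain s where s: "s \<in> S - N" "a' s \<noteq> b' s" "\<And>n. a n s = b n s" by auto
    then show False using LIMSEQ_unique[OF a[of s], of "b' s"] b[of s] by simp
  qed
qed

text \<open>The exceptional set depends on \<open>t\<close>, and an uncountable union of such sets
  may fail to be null. Difference quotients along a single sequence tending to \<open>t\<close>
  involve only countably many of them. The set \<open>N\<close> absorbs points such as the diagonal,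
  where a derivative may be missing.\<close>

lemma negligible_neq_derivative:
  fixes H L :: "real \<Rightarrow> real \<Rightarrow> real"
  assumes neq: "\<And>t. t \<in> {a..b} \<Longrightarrow> negligible {s \<in> S. H t s \<noteq> L t s}"
    and t: "t \<in> {a..b}" and "a < b" and N: "negligible N"
    and H': "\<And>s. s \<in> S - N \<Longrightarrow> ((\<lambda>\<tau>. H \<tau> s) has_real_derivative H' s) (at t within {a..b})"
    and L': "\<And>s. s \<in> S - N \<Longrightarrow> ((\<lambda>\<tau>. L \<tau> s) has_real_derivative L' s) (at t within {a..b})"
  shows "negligible {s \<in> S. H' s \<noteq> L' s}"
proof -
  have "t islimpt {a..b}" using t \<open>a < b\<close> by (simp add: islimpt_Icc)
  then obtain X where X: "\<And>n. X n \<in> {a..b} - {t}" "X \<longlonglongrightarrow> t"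
    unfolding islimpt_sequential by blast
  show ?thesis
  proof (rule negligible_neq_limit[OF _ N])
    show "negligible {s \<in> S. (H (X n) s - H t s) / (X n - t) \<noteq> (L (X n) s - L t s) / (X n - t)}" for n
      by (rule negligible_subset[OF negligible_Un[OF neq[of "X n"] neq[OF t]]]) (use X in auto)
    show "(\<lambda>n. (H (X n) s - H t s) / (X n - t)) \<longlonglongrightarrow> H' s" if "s \<in> S - N" for s
      using H'[OF that] X unfolding has_field_derivative_iff tendsto_at_iff_sequentially comp_def by blast
    show "(\<lambda>n. (L (X n) s - L t s) / (X n - t)) \<longlonglongrightarrow> L' s" if "s \<in> S - N" for s
      using L'[OF that] X unfolding has_field_derivative_iff tendsto_at_iff_sequentially comp_def by blast
  qed
qed

text \<open>Test functions are continuous approximations of \<open>sgn h\<close>.\<close>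
lemma orthogonal_to_continuous_imp_negligible:
  fixes h :: "real \<Rightarrow> real"
  assumes h: "h absolutely_integrable_on {a..b}"
    and orth: "\<And>\<phi>. continuous_on {a..b} \<phi> \<Longrightarrow> integral {a..b} (\<lambda>s. h s * \<phi> s) = 0"
  shows "negligible {s \<in> {a..b}. h s \<noteq> 0}"
proof -
  have meas: "h \<in> borel_measurable (lebesgue_on {a..b})"
    by (rule absolutely_integrable_imp_borel_measurable[OF h]) simp
  then have "(\<lambda>s. sgn (h s)) \<in> borel_measurable (lebesgue_on {a..b})"
    by measurable
  then have "(\<lambda>s. sgn (h s)) measurable_on {a..b}"
    by (subst measurable_on_iff_borel_measurable) simp_all
  then obtain N \<psi> where N: "negligible N" and \<psi>: "\<And>n. continuous_on UNIV (\<psi> n)"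
    and lim: "\<And>s. s \<notin> N \<Longrightarrow> (\<lambda>n. \<psi> n s) \<longlonglongrightarrow> (if s \<in> {a..b} then sgn (h s) else 0)"
    unfolding measurable_on_def by blast
  \<comment> \<open>Clipping to [-1, 1] does not disturb the limit, because \<open>sgn\<close> takes
    values there, and it makes \<bar>h\<bar> a majorant of the products.\<close>
  define \<phi> :: "nat \<Rightarrow> real \<Rightarrow> real" where "\<phi> n s = max (-1) (min 1 (\<psi> n s))" for n s
  have \<phi>_cont: "continuous_on {a..b} (\<phi> n)" for n
    unfolding \<phi>_def by (intro continuous_intros continuous_on_subset[OF \<psi>]) auto
  have \<phi>_bound: "\<bar>\<phi> n s\<bar> \<le> 1" for n s by (auto simp: \<phi>_def)
  have \<phi>_lim: "(\<lambda>n. \<phi> n s) \<longlonglongrightarrow> sgn (h s)" if "s \<in> {a..b} - N" for s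
  proof -
    have "(\<lambda>n. \<phi> n s) \<longlonglongrightarrow> max (-1) (min 1 (sgn (h s)))"
      unfolding \<phi>_def using lim[of s] that by (intro tendsto_intros) auto
    then show ?thesis by (cases "h s" "0::real" rule: linorder_cases) auto
  qed
  have prod_int: "(\<lambda>s. h s * \<phi> n s) integrable_on {a..b}" for n
  proof -
    have "(\<lambda>s. \<phi> n s * h s) absolutely_integrable_on {a..b}"
      using \<phi>_bound
      by (intro absolutely_integrable_bounded_measurable_product_real h boundedI[where B=1]
          continuous_imp_measurable_on_sets_lebesgue \<phi>_cont) auto
    then show ?thesis by (simp add: mult.commute set_lebesgue_integral_eq_integral(1))
  qed
  have abs_int: "(\<lambda>s. \<bar>h s\<bar>) integrable_on {a..b}"
    using h by (simp add: absolutely_integrable_on_def)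
  \<comment> \<open>The limit uses h * sgn h = \<bar>h\<bar>. Values on \<open>N\<close> are
    replaced by 0 to obtain convergence at every point.\<close>
  have "(\<lambda>n. integral {a..b} (\<lambda>s. if s \<in> N then 0 else h s * \<phi> n s)) \<longlonglongrightarrow>
      integral {a..b} (\<lambda>s. if s \<in> N then 0 else \<bar>h s\<bar>)"
  proof (rule dominated_convergence(2)[OF _ abs_int])
    show "(\<lambda>s. if s \<in> N then 0 else h s * \<phi> n s) integrable_on {a..b}" for n
      by (rule integrable_spike[OF prod_int N]) auto
    show "norm (if s \<in> N then 0 else h s * \<phi> n s) \<le> \<bar>h s\<bar>" for n s
      using mult_left_mono[OF \<phi>_bound, of "\<bar>h s\<bar>" n s] by (simp add: abs_mult)
    show "(\<lambda>n. if s \<in> N then 0 else h s * \<phi> n s) \<longlonglongrightarrow> (if s \<in> N then 0 else \<bar>h s\<bar>)"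
      if "s \<in> {a..b}" for s
      using tendsto_mult_left[OF \<phi>_lim, of s "h s"] that by (auto simp: abs_sgn)
  qed
  moreover have "integral {a..b} (\<lambda>s. if s \<in> N then 0 else h s * \<phi> n s) = 0" for n
    using integral_spike[OF N, of "{a..b}" "\<lambda>s. if s \<in> N then 0 else h s * \<phi> n s" "\<lambda>s. h s * \<phi> n s"]
      orth[OF \<phi>_cont] by simp
  moreover have "integral {a..b} (\<lambda>s. if s \<in> N then 0 else \<bar>h s\<bar>) = integral {a..b} (\<lambda>s. \<bar>h s\<bar>)"
    by (rule integral_spike[OF N]) auto
  ultimately have zero: "integral {a..b} (\<lambda>s. \<bar>h s\<bar>) = 0"
    by (simp add: LIMSEQ_const_iff)
  have int: "integrable (lebesgue_on {a..b}) h"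
    using h by (simp add: absolutely_integrable_imp_integrable)
  have "integral\<^sup>L (lebesgue_on {a..b}) (\<lambda>s. \<bar>h s\<bar>) = 0"
    using zero int by (simp add: lebesgue_integral_eq_integral)
  then have "emeasure (lebesgue_on {a..b}) {s \<in> {a..b}. h s \<noteq> 0} = 0"
    using integral_0_iff[OF int] by simp
  moreover have sets: "{s \<in> {a..b}. h s \<noteq> 0} \<in> sets (lebesgue_on {a..b})"
    using borel_measurable_neq[OF meas borel_measurable_const[of 0]] by simp
  ultimately have "{s \<in> {a..b}. h s \<noteq> 0} \<in> null_sets lebesgue"
    by (auto simp: null_sets_def emeasure_restrict_space sets_restrict_space_iff)
  then show ?thesis by (simp add: negligible_iff_null_sets)
qed

section \<open>Sign and size of integrals against a kernel known almost everywhere\<close>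

lemma sigma_cases: "sigma H = 1 \<or> sigma H = -1"
  by (simp add: sigma_def)

text \<open>The value -1 is the default of \<open>sigma\<close>, so it signifies a nonpositive
  function only once mixed signs are excluded.\<close>

lemma sigma_mult_eq_abs:
  assumes "constant_sign H" "t \<in> {0..1}" "s \<in> {0..1}"
  shows "sigma H * H t s = \<bar>H t s\<bar>"
  using assms by (auto simp: constant_sign_def sigma_def)

text \<open>The two kernels share the work: \<open>L\<close> supplies measurability and boundedness,
  \<open>H\<close> the sign and the constant. Integrals do not see the null set on which they
  differ.\<close>

lemma kernel_estimates:
  fixes H L :: "real \<Rightarrow> real \<Rightarrow> real" and \<phi> :: "real \<Rightarrow> real"
  assumes neq: "\<forall>t\<in>{0..1}. negligible {s \<in> {0..1}. H t s \<noteq> L t s}"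
    and meas: "\<forall>t\<in>{0..1}. L t \<in> borel_measurable (lebesgue_on {0..1})"
    and bound: "\<forall>t\<in>{0..1}. \<forall>s\<in>{0..1}. \<bar>L t s\<bar> \<le> C"
    and \<phi>: "\<phi> \<in> borel_measurable (lebesgue_on {0..1})" "\<forall>s\<in>{0..1}. 0 \<le> \<phi> s \<and> \<phi> s \<le> M"
    and t: "t \<in> {0..1}"
  shows "(\<lambda>s. \<phi> s * L t s) integrable_on {0..1}"
    and "\<bar>integral {0..1} (\<lambda>s. \<phi> s * L t s)\<bar> \<le> (SUP t\<in>{0..1}. integral {0..1} (\<lambda>s. \<bar>H t s\<bar>)) * M"
    and "constant_sign H \<Longrightarrow> 0 \<le> sigma H * integral {0..1} (\<lambda>s. \<phi> s * L t s)"
proof -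
  have M: "0 \<le> M" using \<phi>(2)[rule_format, of 0] by auto
  have absL: "(\<lambda>s. \<bar>L r s\<bar>) integrable_on {0..1}" if r: "r \<in> {0..1}" for r
  proof (rule measurable_bounded_by_integrable_imp_integrable)
    show "(\<lambda>s. \<bar>L r s\<bar>) \<in> borel_measurable (lebesgue_on {0..1})"
      using meas[rule_format, OF r] by measurable
    show "(\<lambda>_. C) integrable_on {0..1::real}" by (rule integrable_const_ivl)
  qed (use bound r in auto)
  have absH: "integral {0..1} (\<lambda>s. \<bar>H r s\<bar>) = integral {0..1} (\<lambda>s. \<bar>L r s\<bar>)" if r: "r \<in> {0..1}" for r
    by (rule integral_spike[OF neq[rule_format, OF r]]) auto
  \<comment> \<open>An integral lies below the supremum only if the family is bounded above; the
    bound is inherited from \<open>L\<close>.\<close>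
  have bdd: "bdd_above ((\<lambda>t. integral {0..1} (\<lambda>s. \<bar>H t s\<bar>)) ` {0..1})"
  proof (rule bdd_aboveI2)
    fix r :: real assume r: "r \<in> {0..1}"
    have "integral {0..1} (\<lambda>s. \<bar>L r s\<bar>) \<le> integral {0..1::real} (\<lambda>_. C)"
      using bound r by (intro integral_le absL integrable_const_ivl) auto
    then show "integral {0..1} (\<lambda>s. \<bar>H r s\<bar>) \<le> C" by (simp add: absH[OF r])
  qed
  have pointwise: "norm (\<phi> s * L t s) \<le> M * \<bar>L t s\<bar>" if "s \<in> {0..1}" for s
    using \<phi>(2)[rule_format, OF that] by (auto simp: abs_mult intro!: mult_right_mono)
  have dom: "(\<lambda>s. M * \<bar>L t s\<bar>) integrable_on {0..1}"
    using absL[OF t] by (rule integrable_on_mult_right)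
  show int: "(\<lambda>s. \<phi> s * L t s) integrable_on {0..1}"
    by (rule measurable_bounded_by_integrable_imp_integrable[OF borel_measurable_times[OF \<phi>(1) meas[rule_format, OF t]] dom])
      (use pointwise in auto)
  have "\<bar>integral {0..1} (\<lambda>s. \<phi> s * L t s)\<bar> \<le> integral {0..1} (\<lambda>s. M * \<bar>L t s\<bar>)"
    using integral_norm_bound_integral[OF int dom pointwise] by simp
  also have "\<dots> = integral {0..1} (\<lambda>s. \<bar>H t s\<bar>) * M"
    by (simp add: absH[OF t])
  also have "\<dots> \<le> (SUP t\<in>{0..1}. integral {0..1} (\<lambda>s. \<bar>H t s\<bar>)) * M"
    by (intro mult_right_mono cSUP_upper bdd t M)
  finally show "\<bar>integral {0..1} (\<lambda>s. \<phi> s * L t s)\<bar> \<le> \<dots>" .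
  assume sign: "constant_sign H"
  have absL_t: "\<bar>H t s\<bar> = sigma H * L t s" if "s \<in> {0..1} - {s \<in> {0..1}. H t s \<noteq> L t s}" for s
    using sigma_mult_eq_abs[OF sign t, of s] that by auto
  have "sigma H * integral {0..1} (\<lambda>s. \<phi> s * L t s) = integral {0..1} (\<lambda>s. sigma H * (\<phi> s * L t s))"
    by simp
  also have "\<dots> = integral {0..1} (\<lambda>s. \<phi> s * \<bar>H t s\<bar>)"
    by (rule integral_spike[OF neq[rule_format, OF t]]) (subst absL_t, assumption, simp)
  also have "0 \<le> \<dots>"
  proof (rule Henstock_Kurzweil_Integration.integral_nonneg)
    show "(\<lambda>s. \<phi> s * \<bar>H t s\<bar>) integrable_on {0..1}"
      by (rule integrable_spike[OF integrable_on_mult_right[OF int, of "sigma H"] neq[rule_format, OF t]])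
        (subst absL_t, assumption, simp)
  qed (use \<phi>(2) in auto)
  finally show "0 \<le> sigma H * integral {0..1} (\<lambda>s. \<phi> s * L t s)" .
qed

section \<open>The explicit kernel\<close>

text \<open>Expanding the powers of t - s writes the integrals as polynomials in t times moments of
  \<phi> over [0, t]. The fundamental theorem and the product rule then suffice, and the terms
  containing \<phi> t cancel in the last two claims.\<close>

lemma integral_polynomial_kernel_derivative:
  fixes \<phi> :: "real \<Rightarrow> real"
  assumes \<phi>: "continuous_on {0..1} \<phi>" and t: "t \<in> {0..1}"
  shows "((\<lambda>t. integral {0..t} \<phi>) has_real_derivative \<phi> t) (at t within {0..1})"
    and "((\<lambda>t. integral {0..t} (\<lambda>s. (t - s) * \<phi> s)) has_real_derivative integral {0..t} \<phi>)
          (at t within {0..1})"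
    and "((\<lambda>t. integral {0..t} (\<lambda>s. (t - s)\<^sup>2 / 2 * \<phi> s)) has_real_derivative
          integral {0..t} (\<lambda>s. (t - s) * \<phi> s)) (at t within {0..1})"
proof -
  define m where "m n t = integral {0..t} (\<lambda>s. s ^ n * \<phi> s)" for n and t :: real
  have int: "(\<lambda>s. s ^ n * \<phi> s) integrable_on {0..r}" if "r \<in> {0..1}" for n r
    using that by (intro integrable_continuous_real continuous_intros continuous_on_subset[OF \<phi>]) auto
  have m: "(m n has_real_derivative t ^ n * \<phi> t) (at t within {0..1})" for n
    unfolding m_def using t by (intro integral_has_real_derivative continuous_intros \<phi>)
  show "((\<lambda>t. integral {0..t} \<phi>) has_real_derivative \<phi> t) (at t within {0..1})"
    using m[of 0] unfolding m_def by simp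
  have 1: "integral {0..r} (\<lambda>s. (r - s) * \<phi> s) = r * m 0 r - m 1 r" if r: "r \<in> {0..1}" for r
  proof -
    have "integral {0..r} (\<lambda>s. (r - s) * \<phi> s) = integral {0..r} (\<lambda>s. r * (s ^ 0 * \<phi> s) - s ^ 1 * \<phi> s)"
      by (intro integral_cong) (simp add: algebra_simps)
    also have "\<dots> = r * m 0 r - m 1 r"
      unfolding m_def
      by (subst integral_diff) (intro int r integrable_on_mult_right | simp)+
    finally show ?thesis .
  qed
  have 2: "integral {0..r} (\<lambda>s. (r - s)\<^sup>2 / 2 * \<phi> s) = r\<^sup>2 / 2 * m 0 r - r * m 1 r + m 2 r / 2"
    if r: "r \<in> {0..1}" for r
  proof -
    have "integral {0..r} (\<lambda>s. (r - s)\<^sup>2 / 2 * \<phi> s)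
        = integral {0..r} (\<lambda>s. (r\<^sup>2 / 2 * (s ^ 0 * \<phi> s) - r * (s ^ 1 * \<phi> s)) + 1 / 2 * (s ^ 2 * \<phi> s))"
      by (intro integral_cong) (simp add: field_simps power2_eq_square)
    also have "\<dots> = integral {0..r} (\<lambda>s. r\<^sup>2 / 2 * (s ^ 0 * \<phi> s)) - integral {0..r} (\<lambda>s. r * (s ^ 1 * \<phi> s))
        + integral {0..r} (\<lambda>s. 1 / 2 * (s ^ 2 * \<phi> s))"
      by (intro trans[OF integral_add] arg_cong2[where f="(+)"] integral_diff refl
          integrable_diff integrable_on_mult_right int r)
    also have "\<dots> = r\<^sup>2 / 2 * m 0 r - r * m 1 r + m 2 r / 2"
      unfolding m_def integral_mult_right by simp
    finally show ?thesis .
  qed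
  have "((\<lambda>t. t * m 0 t - m 1 t) has_real_derivative m 0 t) (at t within {0..1})"
    using m[of 0] m[of 1] by (auto intro!: derivative_eq_intros)
  then show "((\<lambda>t. integral {0..t} (\<lambda>s. (t - s) * \<phi> s)) has_real_derivative integral {0..t} \<phi>)
          (at t within {0..1})"
    using t 1 has_field_derivative_transform_within[of "\<lambda>t. t * m 0 t - m 1 t" _ t "{0..1}" 1]
    by (simp add: m_def)
  have "((\<lambda>t. t\<^sup>2 / 2 * m 0 t - t * m 1 t + m 2 t / 2) has_real_derivative t * m 0 t - m 1 t)
      (at t within {0..1})"
    using m[of 0] m[of 1] m[of 2]
    by (auto intro!: derivative_eq_intros simp: power2_eq_square algebra_simps)
  then show "((\<lambda>t. integral {0..t} (\<lambda>s. (t - s)\<^sup>2 / 2 * \<phi> s)) has_real_derivative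
          integral {0..t} (\<lambda>s. (t - s) * \<phi> s)) (at t within {0..1})"
    using t 1 2
      has_field_derivative_transform_within[of "\<lambda>t. t\<^sup>2 / 2 * m 0 t - t * m 1 t + m 2 t / 2" _ t "{0..1}" 1]
    by simp
qed

lemma has_integral_truncated:
  fixes c \<phi> :: "real \<Rightarrow> real"
  assumes "t \<in> {0..1}" "continuous_on {0..1} c" "continuous_on {0..1} \<phi>"
  shows "((\<lambda>s. (if s \<le> t then c s else 0) * \<phi> s) has_integral integral {0..t} (\<lambda>s. c s * \<phi> s)) {0..1}"
proof -
  have "(\<lambda>s. c s * \<phi> s) integrable_on {0..t}"
    using assms by (intro integrable_continuous_real continuous_intros) (auto intro: continuous_on_subset)
  then have "((\<lambda>s. if s \<in> {0..t} then c s * \<phi> s else 0) has_integral integral {0..t} (\<lambda>s. c s * \<phi> s)) {0..1}"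
    using assms(1) by (subst has_integral_restrict) (auto simp: integrable_integral)
  then show ?thesis
    by (rule has_integral_eq[rotated]) auto
qed

text \<open>This is B_3 applied in the variable t to the Volterra kernel (t - s)^2 / 2.\<close>

definition boundary_weight :: "(nat \<Rightarrow> real) \<Rightarrow> (nat \<Rightarrow> real) \<Rightarrow> (nat \<Rightarrow> real) \<Rightarrow> real \<Rightarrow> real" where
  "boundary_weight \<alpha> \<beta> \<gamma> s = \<alpha> 3 * ((1 - s)\<^sup>2 / 2) + \<beta> 3 * (1 - s) + \<gamma> 3"

lemma continuous_on_boundary_weight: "continuous_on S (boundary_weight \<alpha> \<beta> \<gamma>)"
  unfolding boundary_weight_def by (intro continuous_intros) auto

text \<open>The left-hand side is B_3 of the solution of u''' = \<phi> with zero initial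
  data.\<close>

lemma boundary_weight_integral:
  assumes \<phi>: "continuous_on {0..1} \<phi>"
  shows "\<alpha> 3 * integral {0..1} (\<lambda>s. (1 - s)\<^sup>2 / 2 * \<phi> s) + \<beta> 3 * integral {0..1} (\<lambda>s. (1 - s) * \<phi> s)
      + \<gamma> 3 * integral {0..1} \<phi> = integral {0..1} (\<lambda>s. boundary_weight \<alpha> \<beta> \<gamma> s * \<phi> s)"
proof -
  have "((\<lambda>s. \<alpha> 3 * ((1 - s)\<^sup>2 / 2 * \<phi> s) + \<beta> 3 * ((1 - s) * \<phi> s) + \<gamma> 3 * \<phi> s) has_integral
     (\<alpha> 3 * integral {0..1} (\<lambda>s. (1 - s)\<^sup>2 / 2 * \<phi> s) + \<beta> 3 * integral {0..1} (\<lambda>s. (1 - s) * \<phi> s)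
      + \<gamma> 3 * integral {0..1} \<phi>)) {0..1}"
    by (intro has_integral_add has_integral_mult_right integrable_integral integrable_continuous_real
        continuous_intros \<phi>) auto
  then have "integral {0..1} (\<lambda>s. \<alpha> 3 * ((1 - s)\<^sup>2 / 2 * \<phi> s) + \<beta> 3 * ((1 - s) * \<phi> s) + \<gamma> 3 * \<phi> s)
    = \<alpha> 3 * integral {0..1} (\<lambda>s. (1 - s)\<^sup>2 / 2 * \<phi> s) + \<beta> 3 * integral {0..1} (\<lambda>s. (1 - s) * \<phi> s)
      + \<gamma> 3 * integral {0..1} \<phi>"
    by (rule integral_unique)
  moreover have "integral {0..1} (\<lambda>s. \<alpha> 3 * ((1 - s)\<^sup>2 / 2 * \<phi> s) + \<beta> 3 * ((1 - s) * \<phi> s) + \<gamma> 3 * \<phi> s)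
    = integral {0..1} (\<lambda>s. boundary_weight \<alpha> \<beta> \<gamma> s * \<phi> s)"
    by (intro integral_cong) (simp add: boundary_weight_def algebra_simps)
  ultimately show ?thesis by simp
qed

text \<open>Here \<open>p\<close> is a quadratic polynomial, described by its derivatives, with
  B_1[p] = B_2[p] = 0. The condition \<open>bc3\<close> expresses B_3[p] = -1; multiplied by the
  integral, it also holds when the weight vanishes identically.\<close>

locale third_order_kernel =
  fixes \<alpha> \<beta> \<gamma> :: "nat \<Rightarrow> real" and p p1 p2 :: "real \<Rightarrow> real"
  assumes p_deriv: "t \<in> {0..1} \<Longrightarrow> (p has_real_derivative p1 t) (at t within {0..1})"
    and p1_deriv: "t \<in> {0..1} \<Longrightarrow> (p1 has_real_derivative p2 t) (at t within {0..1})"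
    and p2_continuous: "continuous_on {0..1} p2"
    and p2_deriv: "t \<in> {0<..<1} \<Longrightarrow> (p2 has_real_derivative 0) (at t)"
    and bc1: "\<alpha> 1 * p 0 + \<beta> 1 * p1 0 + \<gamma> 1 * p2 0 = 0"
    and bc2: "\<alpha> 2 * p 0 + \<beta> 2 * p1 0 + \<gamma> 2 * p2 0 = 0"
    and bc3: "continuous_on {0..1} \<phi> \<Longrightarrow> (\<alpha> 3 * p 1 + \<beta> 3 * p1 1 + \<gamma> 3 * p2 1) *
          integral {0..1} (\<lambda>s. boundary_weight \<alpha> \<beta> \<gamma> s * \<phi> s) =
          - integral {0..1} (\<lambda>s. boundary_weight \<alpha> \<beta> \<gamma> s * \<phi> s)"
begin

abbreviation "q \<equiv> boundary_weight \<alpha> \<beta> \<gamma>"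

definition "K0 t s = (if s \<le> t then (t - s)\<^sup>2 / 2 else 0) + p t * q s"
definition "K1 t s = (if s \<le> t then t - s else 0) + p1 t * q s"
definition "K2 t s = (if s \<le> t then 1 else 0) + p2 t * q s"

section \<open>The linear problem solved by the explicit kernel\<close>

lemma K_has_integral:
  assumes "t \<in> {0..1}" and \<phi>: "continuous_on {0..1} \<phi>"
  shows "((\<lambda>s. K0 t s * \<phi> s) has_integral
      integral {0..t} (\<lambda>s. (t - s)\<^sup>2 / 2 * \<phi> s) + p t * integral {0..1} (\<lambda>s. q s * \<phi> s)) {0..1}"
    and "((\<lambda>s. K1 t s * \<phi> s) has_integral
      integral {0..t} (\<lambda>s. (t - s) * \<phi> s) + p1 t * integral {0..1} (\<lambda>s. q s * \<phi> s)) {0..1}"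
    and "((\<lambda>s. K2 t s * \<phi> s) has_integral
      integral {0..t} \<phi> + p2 t * integral {0..1} (\<lambda>s. q s * \<phi> s)) {0..1}"
proof -
  have q: "((\<lambda>s. q s * \<phi> s) has_integral integral {0..1} (\<lambda>s. q s * \<phi> s)) {0..1}"
    by (intro integrable_integral integrable_continuous_real continuous_intros continuous_on_boundary_weight \<phi>)
  have *: "((\<lambda>s. ((if s \<le> t then c s else 0) + r * q s) * \<phi> s) has_integral
      integral {0..t} (\<lambda>s. c s * \<phi> s) + r * integral {0..1} (\<lambda>s. q s * \<phi> s)) {0..1}"
    if "continuous_on {0..1} c" for c r
    using has_integral_add[OF has_integral_truncated[OF assms(1) that \<phi>] has_integral_mult_right[OF q, of r]]
    by (simp add: distrib_right mult.assoc)
  show "((\<lambda>s. K0 t s * \<phi> s) has_integral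
      integral {0..t} (\<lambda>s. (t - s)\<^sup>2 / 2 * \<phi> s) + p t * integral {0..1} (\<lambda>s. q s * \<phi> s)) {0..1}"
    unfolding K0_def by (rule *) (intro continuous_intros, auto)
  show "((\<lambda>s. K1 t s * \<phi> s) has_integral
      integral {0..t} (\<lambda>s. (t - s) * \<phi> s) + p1 t * integral {0..1} (\<lambda>s. q s * \<phi> s)) {0..1}"
    unfolding K1_def by (rule *) (intro continuous_intros)
  show "((\<lambda>s. K2 t s * \<phi> s) has_integral
      integral {0..t} \<phi> + p2 t * integral {0..1} (\<lambda>s. q s * \<phi> s)) {0..1}"
    using *[of "\<lambda>_. 1" "p2 t"] by (simp add: K2_def)
qed

text \<open>The Volterra part has third derivative \<phi> and zero data at 0, so it satisfies B_1
  and B_2. The multiple of \<open>p\<close> changes neither the third derivative nor these two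
  conditions, and it cancels B_3 of the Volterra part.\<close>

lemma kernel_solves:
  assumes \<phi>: "continuous_on {0..1} \<phi>"
  defines "u \<equiv> \<lambda>t. integral {0..1} (\<lambda>s. K0 t s * \<phi> s)"
    and "u1 \<equiv> \<lambda>t. integral {0..1} (\<lambda>s. K1 t s * \<phi> s)"
    and "u2 \<equiv> \<lambda>t. integral {0..1} (\<lambda>s. K2 t s * \<phi> s)"
  shows "third_order_sol u u1 u2 \<phi>" and "bcs_hold \<alpha> \<beta> \<gamma> u u1 u2"
proof -
  define c where "c = integral {0..1} (\<lambda>s. q s * \<phi> s)"
  have u: "u t = integral {0..t} (\<lambda>s. (t - s)\<^sup>2 / 2 * \<phi> s) + p t * c"
    and u1: "u1 t = integral {0..t} (\<lambda>s. (t - s) * \<phi> s) + p1 t * c"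
    and u2: "u2 t = integral {0..t} \<phi> + p2 t * c" if "t \<in> {0..1}" for t
    unfolding u_def u1_def u2_def c_def using K_has_integral[OF that \<phi>] by (auto intro: integral_unique)
  have transform: "(w has_real_derivative w') (at t within {0..1})"
    if "(v has_real_derivative w') (at t within {0..1})" "\<And>r. r \<in> {0..1} \<Longrightarrow> w r = v r" "t \<in> {0..1}"
    for v w w' t
    by (rule has_field_derivative_transform_within[OF that(1) zero_less_one that(3)]) (simp add: that(2))
  have "(u has_real_derivative u1 t) (at t within {0..1})" if "t \<in> {0..1}" for t
    unfolding u1[OF that]
    by (rule transform[OF _ u that]) (intro DERIV_add DERIV_cmult_right integral_polynomial_kernel_derivative \<phi> that p_deriv)
  moreover have "(u1 has_real_derivative u2 t) (at t within {0..1})" if "t \<in> {0..1}" for t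
    unfolding u2[OF that]
    by (rule transform[OF _ u1 that]) (intro DERIV_add DERIV_cmult_right integral_polynomial_kernel_derivative \<phi> that p1_deriv)
  moreover have "continuous_on {0..1} u2"
  proof -
    have "continuous_on {0..1} (\<lambda>t. integral {0..t} \<phi> + p2 t * c)"
      by (intro continuous_intros p2_continuous DERIV_continuous_on[OF integral_polynomial_kernel_derivative(1)[OF \<phi>]])
    then show ?thesis by (subst continuous_on_cong[OF refl u2])
  qed
  moreover have "(u2 has_real_derivative \<phi> t) (at t)" if "t \<in> {0<..<1}" for t
  proof -
    have t: "t \<in> {0..1}" and at: "at t within {0..1} = at t"
      using that by (auto simp: at_within_Icc_at)
    have "(u2 has_real_derivative \<phi> t + 0 * c) (at t within {0..1})"
      by (rule transform[OF _ u2 t])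
        (rule DERIV_add[OF integral_polynomial_kernel_derivative(1)[OF \<phi> t]
          DERIV_cmult_right[OF has_field_derivative_at_within[OF p2_deriv[OF that]]]])
    then show ?thesis by (simp add: at)
  qed
  ultimately show "third_order_sol u u1 u2 \<phi>"
    by (simp add: third_order_sol_def)
  have "\<alpha> i * u 0 + \<beta> i * u1 0 + \<gamma> i * u2 0 = (\<alpha> i * p 0 + \<beta> i * p1 0 + \<gamma> i * p2 0) * c" for i
    by (simp add: u u1 u2 algebra_simps)
  moreover have "\<alpha> 3 * u 1 + \<beta> 3 * u1 1 + \<gamma> 3 * u2 1 =
      (\<alpha> 3 * integral {0..1} (\<lambda>s. (1 - s)\<^sup>2 / 2 * \<phi> s) + \<beta> 3 * integral {0..1} (\<lambda>s. (1 - s) * \<phi> s)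
      + \<gamma> 3 * integral {0..1} \<phi>) + (\<alpha> 3 * p 1 + \<beta> 3 * p1 1 + \<gamma> 3 * p2 1) * c"
    by (simp add: u u1 u2 algebra_simps)
  moreover have "\<dots> = 0"
    unfolding boundary_weight_integral[OF \<phi>] c_def bc3[OF \<phi>] by simp
  ultimately show "bcs_hold \<alpha> \<beta> \<gamma> u u1 u2"
    using bc1 bc2 by (simp add: bcs_hold_def)
qed

section \<open>Pairing of the Green function with continuous functions\<close>

lemma green_integral_eq:
  assumes "green_function \<alpha> \<beta> \<gamma> G" "continuous_on {0..1} \<phi>" "t \<in> {0..1}"
  shows "integral {0..1} (\<lambda>s. G t s * \<phi> s) = integral {0..1} (\<lambda>s. K0 t s * \<phi> s)"
proof -
  have "bvp_solution \<alpha> \<beta> \<gamma> \<phi> (\<lambda>t. integral {0..1} (\<lambda>s. K0 t s * \<phi> s))"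
    unfolding bvp_solution_def using kernel_solves[OF assms(2)] by blast
  moreover have "\<forall>u. bvp_solution \<alpha> \<beta> \<gamma> \<phi> u \<longrightarrow> (\<forall>t\<in>{0..1}. u t = integral {0..1} (\<lambda>s. G t s * \<phi> s))"
    using assms(1,2) unfolding green_function_def by blast
  ultimately show ?thesis using assms(3) by simp
qed

lemma continuous_on_K0: "continuous_on {0..1} (K0 t)"
proof -
  have "K0 t = (\<lambda>s. (max 0 (t - s))\<^sup>2 / 2 + p t * q s)"
    by (auto simp: K0_def fun_eq_iff)
  then show ?thesis
    by (simp only:) (intro continuous_intros continuous_on_boundary_weight, simp_all)
qed

text \<open>Otherwise the continuous function \<open>K0 t\<close> vanishes on [0, 1]. To the right
  of \<open>t\<close> this says that the polynomial \<open>p t * q s\<close> is zero, so its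
  coefficients are zero, and then \<open>K0 t 0\<close> equals t^2 / 2, a contradiction. At t = 0 or
  t = 1 the kernel section may really vanish.\<close>

lemma K0_not_orthogonal_to_self:
  assumes t: "0 < t" "t < 1"
  shows "integral {0..1} (\<lambda>s. K0 t s * K0 t s) \<noteq> 0"
proof
  assume "integral {0..1} (\<lambda>s. K0 t s * K0 t s) = 0"
  then have zero: "K0 t s = 0" if "s \<in> {0..1}" for s
    using integral_eq_0_iff[of 0 1 "\<lambda>s. K0 t s * K0 t s",
        OF continuous_on_mult[OF continuous_on_K0 continuous_on_K0]] that
    by simp
  have late: "p t * q s = 0" if "t < s" "s \<le> 1" for s
    using zero[of s] that t by (simp add: K0_def)
  have \<gamma>: "p t * \<gamma> 3 = 0"
    using late[of 1] t by (auto simp: boundary_weight_def)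
  \<comment> \<open>In the variable w = 1 - s the weight is a polynomial with constant term
    \<open>\<gamma> 3\<close>. That term is already gone, so a factor w can be divided out.\<close>
  have lin: "p t * (\<alpha> 3 * w / 2 + \<beta> 3) = 0" if "0 < w" "w < 1 - t" for w
  proof -
    have "p t * q (1 - w) = w * (p t * (\<alpha> 3 * w / 2 + \<beta> 3)) + p t * \<gamma> 3"
      by (simp add: boundary_weight_def power2_eq_square algebra_simps)
    then show ?thesis using late[of "1 - w"] that \<gamma> by simp
  qed
  \<comment> \<open>At w = (1 - t) / d the linear factor becomes X / (2 * d) + Y; two values of d,
    here 2 and 4, force X = Y = 0.\<close>
  define X Y where "X = p t * \<alpha> 3 * (1 - t)" and "Y = p t * \<beta> 3"
  have "X / (2 * d) + Y = 0" if "1 < d" for d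
  proof -
    have "(1 - t) / d < 1 - t" using divide_strict_left_mono[of 1 d "1 - t"] that t by simp
    moreover have "X / (2 * d) + Y = p t * (\<alpha> 3 * ((1 - t) / d) / 2 + \<beta> 3)"
      by (simp add: X_def Y_def algebra_simps)
    ultimately show ?thesis using lin[of "(1 - t) / d"] that t by simp
  qed
  from this[of 2] this[of 4] have "X = 0" "Y = 0" by auto
  then have "p t * \<alpha> 3 = 0" "p t * \<beta> 3 = 0"
    using t by (auto simp: X_def Y_def)
  then have "p t * q 0 = 0"
    using t \<gamma> by (auto simp: boundary_weight_def)
  moreover have "t\<^sup>2 / 2 + p t * q 0 = 0"
    using zero[of 0] t by (simp add: K0_def)
  ultimately show False
    using t by (simp only:) simp
qed

section \<open>Derivatives, measurability and bounds of the explicit kernel\<close>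

lemma truncated_derivative:
  fixes c :: "real \<Rightarrow> real"
  assumes "s \<noteq> t" "(c has_real_derivative c') (at t within A)" "t \<in> A"
  shows "((\<lambda>\<tau>. if s \<le> \<tau> then c \<tau> else 0) has_real_derivative (if s \<le> t then c' else 0)) (at t within A)"
proof (cases "s \<le> t")
  case True
  then show ?thesis
    using assms by (simp, intro has_field_derivative_transform_within[OF assms(2), of "t - s"])
      (auto simp: dist_real_def)
next
  case False
  then show ?thesis
    using assms by (simp, intro has_field_derivative_transform_within[OF DERIV_const[of 0], of "s - t"])
      (auto simp: dist_real_def)
qed

lemma K_derivative:
  assumes "s \<noteq> t" and t: "t \<in> {0..1}"
  shows "((\<lambda>\<tau>. K0 \<tau> s) has_real_derivative K1 t s) (at t within {0..1})"
    and "((\<lambda>\<tau>. K1 \<tau> s) has_real_derivative K2 t s) (at t within {0..1})"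
    and "continuous (at t within {0..1}) (\<lambda>\<tau>. K2 \<tau> s)"
proof -
  have "((\<lambda>\<tau>. (\<tau> - s)\<^sup>2 / 2) has_real_derivative t - s) (at t within {0..1})"
    "((\<lambda>\<tau>. \<tau> - s) has_real_derivative 1) (at t within {0..1})"
    by (auto intro!: derivative_eq_intros)
  note trunc = this[THEN truncated_derivative[OF assms(1) _ t]]
  show "((\<lambda>\<tau>. K0 \<tau> s) has_real_derivative K1 t s) (at t within {0..1})"
    "((\<lambda>\<tau>. K1 \<tau> s) has_real_derivative K2 t s) (at t within {0..1})"
    unfolding K0_def K1_def K2_def
    by (intro DERIV_add DERIV_cmult_right trunc p_deriv p1_deriv t)+
  have "continuous (at t within {0..1}) (\<lambda>\<tau>. if s \<le> \<tau> then 1 else 0::real)"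
    using truncated_derivative[OF assms(1) DERIV_const[of 1] t] DERIV_continuous by blast
  moreover have "continuous (at t within {0..1}) p2"
    using p2_continuous t by (simp add: continuous_on_eq_continuous_within)
  ultimately show "continuous (at t within {0..1}) (\<lambda>\<tau>. K2 \<tau> s)"
    unfolding K2_def by (intro continuous_intros)
qed

lemma K_measurable:
  "K0 t \<in> borel_measurable (lebesgue_on {0..1})" "K1 t \<in> borel_measurable (lebesgue_on {0..1})"
  "K2 t \<in> borel_measurable (lebesgue_on {0..1})"
proof -
  have q: "q \<in> borel_measurable borel"
    by (rule borel_measurable_continuous_onI[OF continuous_on_boundary_weight])
  have "K0 t \<in> borel_measurable borel" "K1 t \<in> borel_measurable borel" "K2 t \<in> borel_measurable borel"
    unfolding K0_def[abs_def] K1_def[abs_def] K2_def[abs_def] using q by measurable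
  then show "K0 t \<in> borel_measurable (lebesgue_on {0..1})" "K1 t \<in> borel_measurable (lebesgue_on {0..1})"
    "K2 t \<in> borel_measurable (lebesgue_on {0..1})"
    by (auto intro!: measurable_restrict_space1 measurable_completion)
qed

lemma K_bounded:
  obtains C where "\<And>t s. t \<in> {0..1} \<Longrightarrow> s \<in> {0..1} \<Longrightarrow> \<bar>K0 t s\<bar> \<le> C"
    "\<And>t s. t \<in> {0..1} \<Longrightarrow> s \<in> {0..1} \<Longrightarrow> \<bar>K1 t s\<bar> \<le> C"
    "\<And>t s. t \<in> {0..1} \<Longrightarrow> s \<in> {0..1} \<Longrightarrow> \<bar>K2 t s\<bar> \<le> C"
proof -
  have bounded: "\<exists>B. \<forall>t\<in>{0..1}. \<bar>h t\<bar> \<le> B" if "continuous_on {0..1} h" for h :: "real \<Rightarrow> real"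
    using compact_imp_bounded[OF compact_continuous_image[OF that compact_Icc]] by (auto simp: bounded_iff)
  obtain A0 where A0: "\<And>t. t \<in> {0..1} \<Longrightarrow> \<bar>p t\<bar> \<le> A0"
    using bounded[OF DERIV_continuous_on[OF p_deriv]] by blast
  obtain A1 where A1: "\<And>t. t \<in> {0..1} \<Longrightarrow> \<bar>p1 t\<bar> \<le> A1"
    using bounded[OF DERIV_continuous_on[OF p1_deriv]] by blast
  obtain A2 where A2: "\<And>t. t \<in> {0..1} \<Longrightarrow> \<bar>p2 t\<bar> \<le> A2"
    using bounded[OF p2_continuous] by blast
  obtain B where B: "\<And>t. t \<in> {0..1} \<Longrightarrow> \<bar>q t\<bar> \<le> B"
    using bounded[OF continuous_on_boundary_weight] by blast
  define A where "A = max A0 (max A1 A2)"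
  have *: "\<bar>a + r * q s\<bar> \<le> 1 + A * B" if "\<bar>a\<bar> \<le> 1" "\<bar>r\<bar> \<le> A" "s \<in> {0..1}" for a r s
  proof -
    have "\<bar>r * q s\<bar> \<le> A * B"
      unfolding abs_mult using that B[of s] by (intro mult_mono) auto
    then show ?thesis using that(1) by linarith
  qed
  show thesis
  proof
    fix t s :: real assume ts: "t \<in> {0..1}" "s \<in> {0..1}"
    have "(t - s)\<^sup>2 \<le> 1" using ts by (auto simp: abs_square_le_1 abs_le_iff)
    then show "\<bar>K0 t s\<bar> \<le> 1 + A * B"
      unfolding K0_def using ts A0[of t] by (intro *) (auto simp: A_def)
    show "\<bar>K1 t s\<bar> \<le> 1 + A * B"
      unfolding K1_def using ts A1[of t] by (intro *) (auto simp: A_def)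
    show "\<bar>K2 t s\<bar> \<le> 1 + A * B"
      unfolding K2_def using ts A2[of t] by (intro *) (auto simp: A_def)
  qed
qed

text \<open>The integral of a non-integrable function is the junk value \<open>0\<close>, so integrability of
  \<open>G t\<close> has to be proved. If \<open>G t \<phi>\<close> is not integrable, then \<open>K0 t\<close> is orthogonal to \<open>\<phi>\<close>, hence
  not to \<open>\<phi> + K0 t\<close>, which forces both \<open>G t K0 t\<close> and \<open>G t (\<phi> + K0 t)\<close> to be integrable.\<close>
lemma green_integrable:
  assumes green: "green_function \<alpha> \<beta> \<gamma> G" and t: "0 < t" "t < 1" and \<phi>: "continuous_on {0..1} \<phi>"
  shows "(\<lambda>s. G t s * \<phi> s) integrable_on {0..1}"
proof (rule ccontr)
  assume not: "\<not> ?thesis"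
  have t01: "t \<in> {0..1}" using t by simp
  have G0: "integral {0..1} (\<lambda>s. K0 t s * \<phi> s) = 0"
    using green_integral_eq[OF green \<phi> t01] not_integrable_integral[OF not] by simp
  have nz: "integral {0..1} (\<lambda>s. K0 t s * K0 t s) \<noteq> 0"
    by (rule K0_not_orthogonal_to_self[OF t])
  have int0: "(\<lambda>s. G t s * K0 t s) integrable_on {0..1}"
    using green_integral_eq[OF green continuous_on_K0 t01, of t] nz not_integrable_integral by fastforce
  have "integral {0..1} (\<lambda>s. K0 t s * (\<phi> s + K0 t s)) =
      integral {0..1} (\<lambda>s. K0 t s * \<phi> s) + integral {0..1} (\<lambda>s. K0 t s * K0 t s)"
    unfolding distrib_left
    by (intro integral_add integrable_continuous_real continuous_intros continuous_on_K0 \<phi>)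
  then have "integral {0..1} (\<lambda>s. G t s * (\<phi> s + K0 t s)) \<noteq> 0"
    using green_integral_eq[OF green continuous_on_add[OF \<phi> continuous_on_K0] t01, of t] G0 nz by simp
  then have "(\<lambda>s. G t s * (\<phi> s + K0 t s)) integrable_on {0..1}"
    using not_integrable_integral by blast
  from integrable_diff[OF this int0] show False
    using not by (simp add: algebra_simps)
qed

text \<open>For interior t the constant sign turns integrability into absolute integrability, so
  orthogonality to all continuous functions yields equality almost everywhere. The endpoints follow
  by letting interior points tend to t, since both kernels are continuous in the first variable for
  each fixed s \<noteq> t.\<close>

lemma green_ae_eq_K0:
  assumes green: "green_function \<alpha> \<beta> \<gamma> G" and sign: "constant_sign G"
    and cont: "\<And>s. s \<in> {0..1} \<Longrightarrow> continuous_on {0..1} (\<lambda>t. G t s)" and t: "t \<in> {0..1}"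
  shows "negligible {s \<in> {0..1}. G t s \<noteq> K0 t s}"
proof -
  have inner: "negligible {s \<in> {0..1}. G r s \<noteq> K0 r s}" if r: "0 < r" "r < 1" for r
  proof -
    have r01: "r \<in> {0..1}" using r by simp
    have "G r integrable_on {0..1}"
      using green_integrable[OF green r continuous_on_const[of _ 1]] by simp
    moreover have "(\<lambda>s. \<bar>G r s\<bar>) integrable_on {0..1}"
      by (rule integrable_eq[OF integrable_on_mult_right[OF \<open>G r integrable_on {0..1}\<close>, of "sigma G"]])
        (rule sigma_mult_eq_abs[OF sign r01])
    ultimately have "G r absolutely_integrable_on {0..1}"
      by (simp add: absolutely_integrable_on_def)
    then have "(\<lambda>s. G r s - K0 r s) absolutely_integrable_on {0..1}"
      by (rule set_integral_diff(1)[OF _ absolutely_integrable_continuous_real[OF continuous_on_K0]])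
    then have "negligible {s \<in> {0..1}. G r s - K0 r s \<noteq> 0}"
    proof (rule orthogonal_to_continuous_imp_negligible)
      fix \<phi> :: "real \<Rightarrow> real" assume \<phi>: "continuous_on {0..1} \<phi>"
      have "(\<lambda>s. K0 r s * \<phi> s) integrable_on {0..1}"
        by (intro integrable_continuous_real continuous_intros continuous_on_K0 \<phi>)
      then show "integral {0..1} (\<lambda>s. (G r s - K0 r s) * \<phi> s) = 0"
        using green_integrable[OF green r \<phi>] green_integral_eq[OF green \<phi> r01]
        by (simp add: left_diff_distrib integral_diff)
    qed
    then show ?thesis by simp
  qed
  have "t \<in> closure {0<..<1}"
    using t by (simp add: closure_greaterThanLessThan)
  then obtain X where X: "\<And>n. X n \<in> {0<..<1}" "X \<longlonglongrightarrow> t"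
    unfolding closure_sequential by blast
  have X01: "X n \<in> {0..1}" for n using X(1)[of n] by simp
  have along: "(\<lambda>n. h (X n)) \<longlonglongrightarrow> h t" if "continuous (at t within {0..1}) h" for h :: "real \<Rightarrow> real"
    using that X01 X(2) unfolding continuous_within_sequentially comp_def by blast
  show ?thesis
  proof (rule negligible_neq_limit[where N="{t}"])
    show "negligible {s \<in> {0..1}. G (X n) s \<noteq> K0 (X n) s}" for n
      using X(1)[of n] by (intro inner) auto
    show "(\<lambda>n. G (X n) s) \<longlonglongrightarrow> G t s" if "s \<in> {0..1} - {t}" for s
      using cont[of s] that t by (intro along[of "\<lambda>t. G t s"]) (auto simp: continuous_on_eq_continuous_within)
    show "(\<lambda>n. K0 (X n) s) \<longlonglongrightarrow> K0 t s" if "s \<in> {0..1} - {t}" for s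
      using that t by (intro along[of "\<lambda>t. K0 t s"] DERIV_continuous[OF K_derivative(1)]) auto
  qed auto
qed

end

text \<open>Subtracting the Volterra solution from a boundary value solution with the weight itself as
  right-hand side leaves a quadratic polynomial that satisfies the two conditions at \<open>0\<close>. If the
  weight vanishes, then the normalising division by zero yields the correct choice \<open>p = 0\<close>.\<close>
lemma green_imp_third_order_kernel:
  assumes "green_function \<alpha> \<beta> \<gamma> G"
  obtains p p1 p2 where "third_order_kernel \<alpha> \<beta> \<gamma> p p1 p2"
proof -
  let ?q = "boundary_weight \<alpha> \<beta> \<gamma>"
  note q = continuous_on_boundary_weight[of "{0..1}" \<alpha> \<beta> \<gamma>]
  obtain u u1 u2 where sol: "third_order_sol u u1 u2 ?q" and bcs: "bcs_hold \<alpha> \<beta> \<gamma> u u1 u2"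
    using assms q unfolding green_function_def bvp_solution_def by blast
  \<comment> \<open>B_3 vanishes on \<open>u\<close> and equals \<open>c\<close> on the Volterra
    solution with right-hand side \<open>?q\<close>. The difference therefore has B_3 = -c, and
    dividing by \<open>c\<close> normalises it to -1.\<close>
  define c where "c = integral {0..1} (\<lambda>s. ?q s * ?q s)"
  define p where "p t = (u t - integral {0..t} (\<lambda>s. (t - s)\<^sup>2 / 2 * ?q s)) / c" for t
  define p1 where "p1 t = (u1 t - integral {0..t} (\<lambda>s. (t - s) * ?q s)) / c" for t
  define p2 where "p2 t = (u2 t - integral {0..t} ?q) / c" for t
  note V = integral_polynomial_kernel_derivative[OF q]
  have "third_order_kernel \<alpha> \<beta> \<gamma> p p1 p2"
  proof
    show "(p has_real_derivative p1 t) (at t within {0..1})" if "t \<in> {0..1}" for t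
      unfolding p_def p1_def using sol that V(3)[OF that]
      by (intro DERIV_cdivide DERIV_diff) (auto simp: third_order_sol_def)
    show "(p1 has_real_derivative p2 t) (at t within {0..1})" if "t \<in> {0..1}" for t
      unfolding p1_def p2_def using sol that V(2)[OF that]
      by (intro DERIV_cdivide DERIV_diff) (auto simp: third_order_sol_def)
    show "continuous_on {0..1} p2"
      unfolding p2_def divide_inverse using sol DERIV_continuous_on[OF V(1)]
      by (intro continuous_intros) (auto simp: third_order_sol_def)
    show "(p2 has_real_derivative 0) (at t)" if "t \<in> {0<..<1}" for t
    proof -
      have t: "t \<in> {0..1}" and at: "at t within {0..1} = at t"
        using that by (auto simp: at_within_Icc_at)
      have "(p2 has_real_derivative (?q t - ?q t) / c) (at t)"
        unfolding p2_def using sol that V(1)[OF t]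
        by (intro DERIV_cdivide DERIV_diff) (auto simp: third_order_sol_def at)
      then show ?thesis by simp
    qed
    show "\<alpha> 1 * p 0 + \<beta> 1 * p1 0 + \<gamma> 1 * p2 0 = 0" "\<alpha> 2 * p 0 + \<beta> 2 * p1 0 + \<gamma> 2 * p2 0 = 0"
      using bcs by (simp_all add: p_def p1_def p2_def bcs_hold_def flip: add_divide_distrib)
    fix \<phi> :: "real \<Rightarrow> real" assume \<phi>: "continuous_on {0..1} \<phi>"
    have "\<alpha> 3 * p 1 + \<beta> 3 * p1 1 + \<gamma> 3 * p2 1 = (\<alpha> 3 * u 1 + \<beta> 3 * u1 1 + \<gamma> 3 * u2 1 -
        (\<alpha> 3 * integral {0..1} (\<lambda>s. (1 - s)\<^sup>2 / 2 * ?q s) + \<beta> 3 * integral {0..1} (\<lambda>s. (1 - s) * ?q s)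
      + \<gamma> 3 * integral {0..1} ?q)) / c"
      by (simp add: p_def p1_def p2_def add_divide_distrib diff_divide_distrib algebra_simps)
    also have "\<dots> = - c / c"
      using bcs unfolding boundary_weight_integral[OF q] by (simp add: bcs_hold_def c_def)
    finally have B3: "\<alpha> 3 * p 1 + \<beta> 3 * p1 1 + \<gamma> 3 * p2 1 = - c / c" .
    show "(\<alpha> 3 * p 1 + \<beta> 3 * p1 1 + \<gamma> 3 * p2 1) * integral {0..1} (\<lambda>s. ?q s * \<phi> s) =
          - integral {0..1} (\<lambda>s. ?q s * \<phi> s)"
    proof (cases "c = 0")
      case True
      then have "?q s = 0" if "s \<in> {0..1}" for s
        using integral_eq_0_iff[of 0 1 "\<lambda>s. ?q s * ?q s", OF continuous_on_mult[OF q q]] that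
        by (simp add: c_def)
      then have "integral {0..1} (\<lambda>s. ?q s * \<phi> s) = integral {0..1} (\<lambda>s::real. 0)"
        by (intro integral_cong) auto
      then show ?thesis by simp
    qed (simp add: B3)
  qed
  then show thesis by (rule that)
qed

section \<open>The boundary value problem\<close>

lemma integral_triple:
  fixes a b c :: "real \<Rightarrow> real"
  assumes "a integrable_on S" "b integrable_on S" "c integrable_on S"
  shows "integral S (\<lambda>s. (a s, b s, c s)) = (integral S a, integral S b, integral S c)"
proof -
  have sum: "(\<lambda>s. (a s, b s, c s)) = (\<lambda>s. a s *\<^sub>R (1, 0, 0) + b s *\<^sub>R (0, 1, 0) + c s *\<^sub>R (0, 0, 1))"
    by (simp add: fun_eq_iff)
  have "((\<lambda>s. (a s, b s, c s)) has_integral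
      integral S a *\<^sub>R (1, 0, 0) + integral S b *\<^sub>R (0, 1, 0) + integral S c *\<^sub>R (0, 0, 1)) S"
    unfolding sum by (intro has_integral_add has_integral_scaleR_left integrable_integral assms)
  then show ?thesis by (simp add: integral_unique)
qed

text \<open>The factor \<open>c\<close> treats increasing and decreasing functions at once.\<close>

lemma monotone_of_derivative_sign:
  fixes u v :: "real \<Rightarrow> real"
  assumes deriv: "\<And>t. t \<in> {a..b} \<Longrightarrow> (u has_real_derivative v t) (at t within {a..b})"
    and sign: "\<And>t. t \<in> {a..b} \<Longrightarrow> 0 \<le> c * v t"
    and xy: "x \<in> {a..b}" "y \<in> {a..b}" "x \<le> y"
  shows "c * u x \<le> c * u y"
proof (rule DERIV_nonneg_imp_increasing_open[OF xy(3)])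
  show "\<exists>d. ((\<lambda>t. c * u t) has_real_derivative d) (at z) \<and> 0 \<le> d" if "x < z" "z < y" for z
  proof -
    have z: "z \<in> {a..b}" "at z within {a..b} = at z"
      using that xy by (auto simp: at_within_Icc_at)
    then show ?thesis
      using DERIV_cmult[OF deriv[OF z(1)], of c] sign[OF z(1)] by auto
  qed
  show "continuous_on {x..y} (\<lambda>t. c * u t)"
    using continuous_on_subset[OF DERIV_continuous_on[OF deriv], of "{x..y}"] xy
    by (intro continuous_on_mult_left) auto
qed

theorem theorem2:
  fixes \<alpha> \<beta> \<gamma> :: "nat \<Rightarrow> real"
    and G G1 G2 :: "real \<Rightarrow> real \<Rightarrow> real"
    and f :: "real \<Rightarrow> real \<Rightarrow> real \<Rightarrow> real \<Rightarrow> real"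
    and M :: real
  assumes rank: "rank (bc_matrix \<alpha> \<beta> \<gamma>) = 3"
    and green: "green_function \<alpha> \<beta> \<gamma> G"
    and G1: "\<forall>t\<in>{0..1}. \<forall>s\<in>{0..1}.
               ((\<lambda>\<tau>. G \<tau> s) has_real_derivative G1 t s) (at t within {0..1})"
    and G2: "\<forall>t\<in>{0..1}. \<forall>s\<in>{0..1}. t \<noteq> s \<longrightarrow>
               ((\<lambda>\<tau>. G1 \<tau> s) has_real_derivative G2 t s) (at t within {0..1})"
    and signG: "constant_sign G"
    and signG1: "constant_sign G1"
    and Mpos: "M > 0"
    and fcont: "continuous_on
       {(t, x, y, z). 0 \<le> t \<and> t \<le> 1 \<and>
          0 \<le> x \<and> x \<le> (SUP t\<in>{0..1}. integral {0..1} (\<lambda>s. \<bar>G t s\<bar>)) * M \<and>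
          0 \<le> sigma G * sigma G1 * y \<and>
          sigma G * sigma G1 * y \<le> (SUP t\<in>{0..1}. integral {0..1} (\<lambda>s. \<bar>G1 t s\<bar>)) * M \<and>
          \<bar>z\<bar> \<le> (SUP t\<in>{0..1}. integral {0..1} (\<lambda>s. \<bar>G2 t s\<bar>)) * M}
       (\<lambda>(t, x, y, z). f t x y z)"
    and fbound: "\<forall>t x y z. 0 \<le> t \<and> t \<le> 1 \<and>
          0 \<le> x \<and> x \<le> (SUP t\<in>{0..1}. integral {0..1} (\<lambda>s. \<bar>G t s\<bar>)) * M \<and>
          0 \<le> sigma G * sigma G1 * y \<and>
          sigma G * sigma G1 * y \<le> (SUP t\<in>{0..1}. integral {0..1} (\<lambda>s. \<bar>G1 t s\<bar>)) * M \<and>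
          \<bar>z\<bar> \<le> (SUP t\<in>{0..1}. integral {0..1} (\<lambda>s. \<bar>G2 t s\<bar>)) * M
        \<longrightarrow> 0 \<le> sigma G * f t x y z \<and> sigma G * f t x y z \<le> M"
  shows "\<exists>u u1 u2.
      third_order_sol u u1 u2 (\<lambda>t. f t (u t) (u1 t) (u2 t)) \<and>
      bcs_hold \<alpha> \<beta> \<gamma> u u1 u2 \<and>
      (\<forall>t\<in>{0..1}.
          0 \<le> u t \<and> u t \<le> (SUP t\<in>{0..1}. integral {0..1} (\<lambda>s. \<bar>G t s\<bar>)) * M \<and>
          0 \<le> sigma G * sigma G1 * u1 t \<and>
          sigma G * sigma G1 * u1 t \<le> (SUP t\<in>{0..1}. integral {0..1} (\<lambda>s. \<bar>G1 t s\<bar>)) * M \<and>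
          \<bar>u2 t\<bar> \<le> (SUP t\<in>{0..1}. integral {0..1} (\<lambda>s. \<bar>G2 t s\<bar>)) * M) \<and>
      (mono_on {0..1} u \<or> antimono_on {0..1} u) \<and>
      (sigma G * sigma G1 = 1 \<longrightarrow> mono_on {0..1} u) \<and>
      (sigma G * sigma G1 = -1 \<longrightarrow> antimono_on {0..1} u)"
proof -
  let ?I = "\<lambda>H. SUP t\<in>{0..1::real}. integral {0..1} (\<lambda>s. \<bar>H t s\<bar>)"
  define \<sigma> \<tau> where "\<sigma> = sigma G" and "\<tau> = sigma G1"
  have \<sigma>: "\<sigma> * \<sigma> = 1" and \<sigma>\<tau>: "\<sigma> * \<tau> = 1 \<or> \<sigma> * \<tau> = -1" and abs\<sigma>: "\<bar>\<sigma>\<bar> = 1" "\<bar>\<tau>\<bar> = 1"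
    using sigma_cases[of G] sigma_cases[of G1] by (auto simp: \<sigma>_def \<tau>_def)
  obtain p p1 p2 where "third_order_kernel \<alpha> \<beta> \<gamma> p p1 p2"
    using green_imp_third_order_kernel[OF green] by blast
  then interpret third_order_kernel \<alpha> \<beta> \<gamma> p p1 p2 .
  obtain C where C: "\<And>t s. t \<in> {0..1} \<Longrightarrow> s \<in> {0..1} \<Longrightarrow> \<bar>K0 t s\<bar> \<le> C"
    "\<And>t s. t \<in> {0..1} \<Longrightarrow> s \<in> {0..1} \<Longrightarrow> \<bar>K1 t s\<bar> \<le> C"
    "\<And>t s. t \<in> {0..1} \<Longrightarrow> s \<in> {0..1} \<Longrightarrow> \<bar>K2 t s\<bar> \<le> C"
    using K_bounded by blast

  \<comment> \<open>Agreement of the Green function and its derivatives with the explicit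
    kernel\<close>
  have ae0: "negligible {s \<in> {0..1}. G t s \<noteq> K0 t s}" if "t \<in> {0..1}" for t
  proof (rule green_ae_eq_K0[OF green signG _ that])
    show "continuous_on {0..1} (\<lambda>t. G t s)" if "s \<in> {0..1}" for s
      by (rule DERIV_continuous_on) (use G1 that in blast)
  qed
  have ae1: "negligible {s \<in> {0..1}. G1 t s \<noteq> K1 t s}" if "t \<in> {0..1}" for t
    by (rule negligible_neq_derivative[OF ae0 that zero_less_one negligible_sing[of t]])
      (use that G1 in \<open>auto intro!: K_derivative\<close>)
  \<comment> \<open>The excluded set {t} removes the diagonal, where \<open>K1\<close> may have a
    corner and \<open>G2\<close> is not tied to \<open>G1\<close>.\<close>
  have ae2: "negligible {s \<in> {0..1}. G2 t s \<noteq> K2 t s}" if "t \<in> {0..1}" for t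
    by (rule negligible_neq_derivative[OF ae1 that zero_less_one negligible_sing[of t]])
      (use that G2 in \<open>auto intro!: K_derivative\<close>)

  \<comment> \<open>The associated Hammerstein equation\<close>
  define D :: "(real \<times> real \<times> real \<times> real) set" where "D = {(t, x, y, z). 0 \<le> t \<and> t \<le> 1 \<and> 0 \<le> x \<and> x \<le> ?I G * M \<and>
      0 \<le> \<sigma> * \<tau> * y \<and> \<sigma> * \<tau> * y \<le> ?I G1 * M \<and> \<bar>z\<bar> \<le> ?I G2 * M}"
  \<comment> \<open>The factor \<sigma> moves the values of f into [0, M]. The kernel carries the
    same factor, and \<sigma> * \<sigma> = 1 restores the original equation at the end.\<close>
  define g where "g = (\<lambda>w. \<sigma> * (case w of (t, x, y, z) \<Rightarrow> f t x y z))"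
  define \<kappa> where "\<kappa> t s = (\<sigma> * K0 t s, \<sigma> * K1 t s, \<sigma> * K2 t s)" for t s
  interpret h: hammerstein \<kappa> "C + (C + C)" M g D
  proof
    show "\<kappa> t \<in> borel_measurable (lebesgue_on {0..1})" for t
      unfolding \<kappa>_def by (intro borel_measurable_Pair borel_measurable_times borel_measurable_const K_measurable)
    show "norm (\<kappa> t s) \<le> C + (C + C)" if "t \<in> {0..1}" "s \<in> {0..1}" for t s
    proof -
      have "norm (\<kappa> t s) \<le> \<bar>\<sigma> * K0 t s\<bar> + (\<bar>\<sigma> * K1 t s\<bar> + \<bar>\<sigma> * K2 t s\<bar>)"
        unfolding \<kappa>_def by (metis add_left_mono norm_Pair_le order_trans real_norm_def)
      also have "\<dots> \<le> C + (C + C)"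
        using that by (intro add_mono) (simp_all only: abs_mult abs\<sigma> mult_1 C)
      finally show ?thesis .
    qed
    show "continuous (at t within {0..1}) (\<lambda>\<tau>. \<kappa> \<tau> s)" if "t \<in> {0..1}" "s \<noteq> t" for t s
      unfolding \<kappa>_def
      by (intro continuous_Pair continuous_mult continuous_const K_derivative(3)
          DERIV_continuous[OF K_derivative(1)] DERIV_continuous[OF K_derivative(2)] that)
    show "closed D"
      unfolding D_def case_prod_beta
      by (intro closed_Collect_conj closed_Collect_le continuous_intros)
    show "continuous_on D g"
      unfolding g_def D_def \<sigma>_def \<tau>_def by (intro continuous_on_mult_left fcont)
    show "0 \<le> g w \<and> g w \<le> M" if "w \<in> D" for w
      using that fbound unfolding g_def D_def \<sigma>_def \<tau>_def by auto
    show "0 \<le> M" using Mpos by simp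
  qed

  have est: "(\<lambda>s. \<phi> s * K0 t s) integrable_on {0..1}" "(\<lambda>s. \<phi> s * K1 t s) integrable_on {0..1}"
      "(\<lambda>s. \<phi> s * K2 t s) integrable_on {0..1}"
      "0 \<le> \<sigma> * integral {0..1} (\<lambda>s. \<phi> s * K0 t s)"
      "0 \<le> \<tau> * integral {0..1} (\<lambda>s. \<phi> s * K1 t s)"
      "\<bar>integral {0..1} (\<lambda>s. \<phi> s * K0 t s)\<bar> \<le> ?I G * M"
      "\<bar>integral {0..1} (\<lambda>s. \<phi> s * K1 t s)\<bar> \<le> ?I G1 * M"
      "\<bar>integral {0..1} (\<lambda>s. \<phi> s * K2 t s)\<bar> \<le> ?I G2 * M"
    if \<phi>: "\<phi> \<in> h.Adm" and t: "t \<in> {0..1}" for \<phi> t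
  proof -
    have \<phi>': "\<phi> \<in> borel_measurable (lebesgue_on {0..1})" "\<forall>s\<in>{0..1}. 0 \<le> \<phi> s \<and> \<phi> s \<le> M"
      using \<phi> by (auto simp: h.Adm_def)
    have neq: "\<forall>t\<in>{0..1}. negligible {s \<in> {0..1}. G t s \<noteq> K0 t s}"
      "\<forall>t\<in>{0..1}. negligible {s \<in> {0..1}. G1 t s \<noteq> K1 t s}"
      "\<forall>t\<in>{0..1}. negligible {s \<in> {0..1}. G2 t s \<noteq> K2 t s}"
      by (intro ballI, erule ae0, intro ballI, erule ae1, intro ballI, erule ae2)
    have bound: "\<forall>t\<in>{0..1}. \<forall>s\<in>{0..1}. \<bar>K0 t s\<bar> \<le> C" "\<forall>t\<in>{0..1}. \<forall>s\<in>{0..1}. \<bar>K1 t s\<bar> \<le> C"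
      "\<forall>t\<in>{0..1}. \<forall>s\<in>{0..1}. \<bar>K2 t s\<bar> \<le> C"
      by (intro ballI C, assumption+)+
    note e0 = kernel_estimates[OF neq(1) ballI[OF K_measurable(1)] bound(1) \<phi>' t]
    note e1 = kernel_estimates[OF neq(2) ballI[OF K_measurable(2)] bound(2) \<phi>' t]
    note e2 = kernel_estimates[OF neq(3) ballI[OF K_measurable(3)] bound(3) \<phi>' t]
    show "(\<lambda>s. \<phi> s * K0 t s) integrable_on {0..1}" "(\<lambda>s. \<phi> s * K1 t s) integrable_on {0..1}"
      "(\<lambda>s. \<phi> s * K2 t s) integrable_on {0..1}"
      "0 \<le> \<sigma> * integral {0..1} (\<lambda>s. \<phi> s * K0 t s)"
      "0 \<le> \<tau> * integral {0..1} (\<lambda>s. \<phi> s * K1 t s)"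
      "\<bar>integral {0..1} (\<lambda>s. \<phi> s * K0 t s)\<bar> \<le> ?I G * M"
      "\<bar>integral {0..1} (\<lambda>s. \<phi> s * K1 t s)\<bar> \<le> ?I G1 * M"
      "\<bar>integral {0..1} (\<lambda>s. \<phi> s * K2 t s)\<bar> \<le> ?I G2 * M"
      unfolding \<sigma>_def \<tau>_def by (rule e0(1) e1(1) e2(1) e0(3)[OF signG] e1(3)[OF signG1] e0(2) e1(2) e2(2))+
  qed
  have K: "h.K \<phi> t = (\<sigma> * integral {0..1} (\<lambda>s. \<phi> s * K0 t s), \<sigma> * integral {0..1} (\<lambda>s. \<phi> s * K1 t s),
      \<sigma> * integral {0..1} (\<lambda>s. \<phi> s * K2 t s))" if "\<phi> \<in> h.Adm" "t \<in> {0..1}" for \<phi> t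
  proof -
    have "h.K \<phi> t = integral {0..1} (\<lambda>s. (\<sigma> * (\<phi> s * K0 t s), \<sigma> * (\<phi> s * K1 t s), \<sigma> * (\<phi> s * K2 t s)))"
      unfolding h.K_def \<kappa>_def by (simp add: mult.left_commute)
    also have "\<dots> = (integral {0..1} (\<lambda>s. \<sigma> * (\<phi> s * K0 t s)), integral {0..1} (\<lambda>s. \<sigma> * (\<phi> s * K1 t s)),
        integral {0..1} (\<lambda>s. \<sigma> * (\<phi> s * K2 t s)))"
      by (intro integral_triple integrable_on_mult_right est that)
    finally show ?thesis by simp
  qed
  have in_D: "(t, h.K \<phi> t) \<in> D" if "\<phi> \<in> h.Adm" "t \<in> {0..1}" for \<phi> t
  proof -
    define x y z where "x = integral {0..1} (\<lambda>s. \<phi> s * K0 t s)"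
      and "y = integral {0..1} (\<lambda>s. \<phi> s * K1 t s)" and "z = integral {0..1} (\<lambda>s. \<phi> s * K2 t s)"
    have abs: "\<sigma> * x \<le> \<bar>x\<bar>" "\<tau> * y \<le> \<bar>y\<bar>" "\<bar>\<sigma> * z\<bar> = \<bar>z\<bar>"
      using abs_ge_self[of "\<sigma> * x"] abs_ge_self[of "\<tau> * y"] by (simp_all add: abs_mult abs\<sigma>)
    \<comment> \<open>The second component of \<open>h.K \<phi> t\<close> is
      \<open>\<sigma> * y\<close>, so the two factors \<sigma> cancel and the sign of
      \<open>G1\<close> alone decides the condition on the derivative.\<close>
    have sy: "\<sigma> * \<tau> * (\<sigma> * y) = \<tau> * y"
      using \<sigma> by (metis mult.assoc mult.commute mult_1)
    show ?thesis
      unfolding K[OF that] using abs est[OF that] that(2)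
      by (simp add: D_def sy flip: x_def y_def z_def)
  qed

  \<comment> \<open>The solution, its bounds and its monotonicity\<close>
  obtain \<phi> where \<phi>: "\<phi> \<in> h.Adm" "continuous_on {0..1} \<phi>"
    and fixed: "\<And>t. t \<in> {0..1} \<Longrightarrow> \<phi> t = g (t, h.K \<phi> t)"
    using h.solution_exists[OF in_D] by blast
  define u where "u t = integral {0..1} (\<lambda>s. K0 t s * (\<sigma> * \<phi> s))" for t
  define u1 where "u1 t = integral {0..1} (\<lambda>s. K1 t s * (\<sigma> * \<phi> s))" for t
  define u2 where "u2 t = integral {0..1} (\<lambda>s. K2 t s * (\<sigma> * \<phi> s))" for t
  have u: "h.K \<phi> t = (u t, u1 t, u2 t)" if "t \<in> {0..1}" for t
    unfolding K[OF \<phi>(1) that] u_def u1_def u2_def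
    by (simp add: ac_simps flip: integral_mult_right)
  have \<sigma>\<phi>: "\<sigma> * \<phi> t = f t (u t) (u1 t) (u2 t)" if "t \<in> {0..1}" for t
    unfolding fixed[OF that] u[OF that] g_def using \<sigma> by (simp flip: mult.assoc)
  note solves = kernel_solves[OF continuous_on_mult_left[OF \<phi>(2), of \<sigma>], folded u_def u1_def u2_def]
  \<comment> \<open>Replacing \<sigma> * \<phi> by f is legitimate because the right-hand side
    enters only at points of (0, 1).\<close>
  have sol: "third_order_sol u u1 u2 (\<lambda>t. f t (u t) (u1 t) (u2 t))"
    using solves(1) \<sigma>\<phi> by (simp add: third_order_sol_def)
  have bounds: "\<forall>t\<in>{0..1}. 0 \<le> u t \<and> u t \<le> ?I G * M \<and> 0 \<le> \<sigma> * \<tau> * u1 t \<and> \<sigma> * \<tau> * u1 t \<le> ?I G1 * M \<and>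
      \<bar>u2 t\<bar> \<le> ?I G2 * M"
    using in_D[OF \<phi>(1)] u by (simp add: D_def)
  have monotone: "\<sigma> * \<tau> * u x \<le> \<sigma> * \<tau> * u y" if "x \<in> {0..1}" "y \<in> {0..1}" "x \<le> y" for x y
    using sol bounds by (intro monotone_of_derivative_sign[OF _ _ that, where v=u1]) (auto simp: third_order_sol_def)
  have inc: "mono_on {0..1} u" if "\<sigma> * \<tau> = 1"
    using monotone that by (intro mono_onI) simp
  have dec: "antimono_on {0..1} u" if "\<sigma> * \<tau> = -1"
    using monotone that by (intro monotone_onI) simp
  show ?thesis
    using sol solves(2) bounds inc dec \<sigma>\<tau> unfolding \<sigma>_def \<tau>_def by blast
qed

end
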